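(* Let $b$ be a non-extreme point of the closed unit ball of $H^\infty$ and let $\mathcal H(b)$ be the de Branges–Rovnyak space with kernel $K(z,w)=\frac{1-b(z)\overline{b(w)}}{1-z\overline w}$ on the unit disk. For $\alpha\ge0$ and $h\in\mathcal H(b)$ with Taylor coefficients $\hat h(j)$, let $\sigma_n^\alpha(h):=\sum_{j=0}^n\binom{n}{j}\big/\binom{n+\alpha}{j}\,\hat h(j)z^j$. If $\sigma_n^\alpha(h)\to h$ (weakly or in norm) in $\mathcal H(b)$ for all $h\in\mathcal H(b)$, then \[ \|z^j\|_{\mathcal H(b)}=O(j^\alpha)\quad(j\to\infty). \]
   Context: $H^\infty$ is the space of bounded holomorphic functions on the unit disk with sup-norm; $b$ non-extreme in its unit ball means equivalently $\log(1-|b|^2)\in L^1(\mathbb T)$, in which case $\mathcal H(b)$ contains the polynomials. Binomial coefficients with non-integer arguments are defined via the Gamma function. *)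

theory Defs
  imports "HOL-Complex_Analysis.Complex_Analysis" "HOL-Library.Landau_Symbols"
begin

definition Hinf_ball :: "(complex \<Rightarrow> complex) \<Rightarrow> bool" where
  "Hinf_ball f \<longleftrightarrow> f holomorphic_on ball 0 1 \<and> (\<forall>z\<in>ball 0 1. norm (f z) \<le> 1)"

definition nonextreme :: "(complex \<Rightarrow> complex) \<Rightarrow> bool" where
  "nonextreme b \<longleftrightarrow> Hinf_ball b \<and>
     (\<exists>f1 f2. Hinf_ball f1 \<and> Hinf_ball f2 \<and> (\<exists>z\<in>ball 0 1. f1 z \<noteq> f2 z) \<and>
              (\<forall>z\<in>ball 0 1. b z = (f1 z + f2 z) / 2))"

definition dBR_kernel :: "(complex \<Rightarrow> complex) \<Rightarrow> complex \<Rightarrow> complex \<Rightarrow> complex" where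
  "dBR_kernel b z w = (1 - b z * cnj (b w)) / (1 - z * cnj w)"

text \<open>Aronszajn's description of the RKHS with kernel K:
  f belongs to it with norm at most C iff C^2 K(z,w) - f(z) conj(f(w)) is a positive kernel.\<close>
definition Hb_bound :: "(complex \<Rightarrow> complex) \<Rightarrow> (complex \<Rightarrow> complex) \<Rightarrow> real \<Rightarrow> bool" where
  "Hb_bound b f C \<longleftrightarrow> C \<ge> 0 \<and>
     (\<forall>(n::nat) (zs::nat \<Rightarrow> complex) (cs::nat \<Rightarrow> complex). (\<forall>i<n. zs i \<in> ball 0 1) \<longrightarrow>
        Re (\<Sum>i<n. \<Sum>k<n. cnj (cs i) * cs k *
              ((of_real C)\<^sup>2 * dBR_kernel b (zs i) (zs k) - f (zs i) * cnj (f (zs k)))) \<ge> 0)"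

definition in_Hb :: "(complex \<Rightarrow> complex) \<Rightarrow> (complex \<Rightarrow> complex) \<Rightarrow> bool" where
  "in_Hb b f \<longleftrightarrow> (\<exists>C. Hb_bound b f C)"

definition Hb_norm :: "(complex \<Rightarrow> complex) \<Rightarrow> (complex \<Rightarrow> complex) \<Rightarrow> real" where
  "Hb_norm b f = Inf {C. Hb_bound b f C}"

text \<open>Inner product of H(b), recovered from the norm by polarization.\<close>
definition Hb_inner :: "(complex \<Rightarrow> complex) \<Rightarrow> (complex \<Rightarrow> complex) \<Rightarrow> (complex \<Rightarrow> complex) \<Rightarrow> complex" where
  "Hb_inner b f g = (\<Sum>k<(4::nat). \<i> ^ k * of_real ((Hb_norm b (\<lambda>z. f z + \<i> ^ k * g z))\<^sup>2)) / 4"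

definition taylor_coeff :: "(complex \<Rightarrow> complex) \<Rightarrow> nat \<Rightarrow> complex" where
  "taylor_coeff h j = (deriv ^^ j) h 0 / of_nat (fact j)"

definition sigma_mean :: "real \<Rightarrow> nat \<Rightarrow> (complex \<Rightarrow> complex) \<Rightarrow> complex \<Rightarrow> complex" where
  "sigma_mean \<alpha> n h = (\<lambda>z. \<Sum>j\<le>n.
      of_real (real (n choose j) / ((real n + \<alpha>) gchoose j)) * taylor_coeff h j * z ^ j)"

end

(* Writing b = (f + g)/2 with distinct f, g in the unit ball of H^infinity, the function
   u = (f - g)/2 is nonzero and satisfies |b|^2 + |u|^2 <= 1 on the disk. Hence the co-analytic Toeplitz
   operator with symbol cnj u maps the unit ball of H^2 into that of H(b). If u_p is the first
   nonzero Taylor coefficient of u, the image of z^(n+p) is a polynomial of degree n, of norm at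
   most 1, whose leading coefficient has modulus |u_p|. So H(b) contains the polynomials and the
   norm of the functional "n-th Taylor coefficient" is bounded below by |u_p|.

   Put A_n = binom(n+alpha, n). The generating function of A_n sigma_n(h) is that of the
   terms h_j z^j divided by (1-x)^(alpha+1); the coefficients of (1-x)^(alpha+1) being absolutely
   summable, boundedness of sigma_n(h) gives |h_n| |z^n| = O(A_n) for each h. Uniform
   boundedness, together with the lower bound, yields |z^n| = O(A_n) = O(n^alpha). *)

theory Submission
  imports Defs "HOL-Library.Function_Algebras"
begin

section \<open>Means over the unit circle\<close>

text \<open>The obstacle is that \<open>in_Hb\<close>, \<open>Hb_norm\<close> and
  \<open>Hb_inner\<close> come from Aronszajn's positivity test and not from a given Hilbert space.
  Read as duality, the test makes \<open>Hb_norm b f\<close> the norm of f as a functional on finite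
  combinations of kernels, under the seminorm whose square is \<open>dBR_form\<close>. From this the
  parallelogram law, completeness and uniform boundedness are derived. The parallelogram law matters
  because weak convergence is stated through \<open>Hb_inner\<close>, whose additivity is the
  Jordan-von Neumann argument. The Toeplitz estimate is the operator inequality T_u^* T_u <= I - T_b
  T_b^* on H^2. Contractivity of the column with entries b and u gives T_u^* T_u <= I - T_b^* T_b,
  and T_b T_b^* <= T_b^* T_b for analytic b. It is tested on combinations of Szego kernels, which
  are eigenvectors of T_b^*, so that means over the circle take the place of H^2.\<close>

definition has_circle_mean :: "(complex \<Rightarrow> complex) \<Rightarrow> complex \<Rightarrow> bool" where
  "has_circle_mean f I \<longleftrightarrow> ((\<lambda>t. f (exp (2 * of_real pi * \<i> * of_real t))) has_integral I) {0..1}"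

text \<open>On the circle d zeta = 2 pi i zeta dt, which accounts for the division by the variable
  and for the factor.\<close>

lemma has_circle_mean_contour:
  assumes "((\<lambda>\<zeta>. f \<zeta> / \<zeta>) has_contour_integral (2 * of_real pi * \<i> * I)) (circlepath 0 1)"
  shows "has_circle_mean f I"
proof -
  have "((\<lambda>t. 2 * of_real pi * \<i> * f (exp (2 * of_real pi * \<i> * of_real t))) has_integral (2 * of_real pi * \<i> * I)) {0..1}"
    using assms unfolding has_contour_integral_def
    by (rule has_integral_eq[rotated]) (simp add: vector_derivative_circlepath01, simp add: circlepath)
  from has_integral_mult_right[OF this, of "1 / (2 * of_real pi * \<i>)"]
  show ?thesis by (simp add: has_circle_mean_def)
qed

lemma has_circle_mean_cong:
  assumes "\<And>\<zeta>. norm \<zeta> = 1 \<Longrightarrow> f \<zeta> = g \<zeta>" "I = J"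
  shows "has_circle_mean f I \<longleftrightarrow> has_circle_mean g J"
  unfolding has_circle_mean_def assms(2)
  by (rule has_integral_cong) (auto intro!: assms(1) simp: norm_exp_eq_Re)

lemma has_circle_mean_const: "has_circle_mean (\<lambda>\<zeta>. c) c"
  unfolding has_circle_mean_def using has_integral_const_real[of c 0 1] by simp

lemma has_circle_mean_cmult: "has_circle_mean f I \<Longrightarrow> has_circle_mean (\<lambda>\<zeta>. c * f \<zeta>) (c * I)"
  unfolding has_circle_mean_def by (rule has_integral_mult_right)

lemma has_circle_mean_add:
  "has_circle_mean f I \<Longrightarrow> has_circle_mean g J \<Longrightarrow> has_circle_mean (\<lambda>\<zeta>. f \<zeta> + g \<zeta>) (I + J)"
  unfolding has_circle_mean_def by (rule has_integral_add)

lemma has_circle_mean_diff: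
  "has_circle_mean f I \<Longrightarrow> has_circle_mean g J \<Longrightarrow> has_circle_mean (\<lambda>\<zeta>. f \<zeta> - g \<zeta>) (I - J)"
  unfolding has_circle_mean_def by (rule has_integral_diff)

lemma has_circle_mean_sum:
  "finite A \<Longrightarrow> (\<And>i. i \<in> A \<Longrightarrow> has_circle_mean (f i) (I i)) \<Longrightarrow>
    has_circle_mean (\<lambda>\<zeta>. \<Sum>i\<in>A. f i \<zeta>) (\<Sum>i\<in>A. I i)"
  unfolding has_circle_mean_def by (rule has_integral_sum)

lemma has_circle_mean_nonneg:
  assumes "has_circle_mean f I" "\<And>\<zeta>. norm \<zeta> = 1 \<Longrightarrow> Re (f \<zeta>) \<ge> 0"
  shows "Re I \<ge> 0"
proof -
  have "((\<lambda>t. Re (f (exp (2 * of_real pi * \<i> * of_real t)))) has_integral Re I) {0..1}"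
    using assms(1) unfolding has_circle_mean_def by (rule has_integral_Re)
  then show ?thesis
    by (rule has_integral_nonneg) (auto intro!: assms(2) simp: norm_exp_eq_Re)
qed

text \<open>Cauchy's formula, read as the reproducing property of the Szego kernel: on the circle
  the conjugate of zeta is its inverse, so the conjugated kernel equals zeta / (zeta - w).\<close>

lemma has_circle_mean_szego:
  assumes "continuous_on (cball 0 1) f" "f holomorphic_on ball 0 1" "w \<in> ball 0 1"
  shows "has_circle_mean (\<lambda>\<zeta>. f \<zeta> * cnj (1 / (1 - \<zeta> * cnj w))) (f w)"
proof -
  have "has_circle_mean (\<lambda>\<zeta>. f \<zeta> / (\<zeta> - w) * \<zeta>) (f w)"
    by (rule has_circle_mean_contour, rule has_contour_integral_eq[OF Cauchy_integral_circlepath[of 0 1 f w]])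
       (use assms in auto)
  then show ?thesis
  proof (rule iffD1[OF has_circle_mean_cong, rotated -1])
    fix \<zeta> :: complex assume z: "norm \<zeta> = 1"
    have nz: "\<zeta> \<noteq> 0" using z by auto
    have "cnj \<zeta> * \<zeta> = 1" using z by (metis complex_norm_square mult.commute of_real_1 power_one)
    then have "cnj \<zeta> = 1 / \<zeta>" using nz by (simp add: field_simps)
    then have "cnj (1 - \<zeta> * cnj w) = (\<zeta> - w) / \<zeta>" using nz by (simp add: field_simps)
    then have "cnj (1 / (1 - \<zeta> * cnj w)) = \<zeta> / (\<zeta> - w)" by simp
    then show "f \<zeta> / (\<zeta> - w) * \<zeta> = f \<zeta> * cnj (1 / (1 - \<zeta> * cnj w))" by simp
  qed simp
qed

lemma has_circle_mean_taylor_coeff: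
  assumes "continuous_on (cball 0 1) f" "f holomorphic_on ball 0 1"
  shows "has_circle_mean (\<lambda>\<zeta>. f \<zeta> * cnj \<zeta> ^ k) (taylor_coeff f k)"
proof -
  have "has_circle_mean (\<lambda>\<zeta>. f \<zeta> / \<zeta> ^ Suc k * \<zeta>) (taylor_coeff f k)"
  proof (rule has_circle_mean_contour, rule has_contour_integral_eq)
    show "((\<lambda>\<zeta>. f \<zeta> / \<zeta> ^ Suc k) has_contour_integral 2 * of_real pi * \<i> * taylor_coeff f k) (circlepath 0 1)"
      using Cauchy_has_contour_integral_higher_derivative_circlepath[of 0 1 f 0 k] assms
      by (simp add: taylor_coeff_def)
  qed auto
  then show ?thesis
  proof (rule iffD1[OF has_circle_mean_cong, rotated -1])
    fix \<zeta> :: complex assume z: "norm \<zeta> = 1"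
    have nz: "\<zeta> \<noteq> 0" using z by auto
    have "cnj \<zeta> * \<zeta> = 1" using z by (metis complex_norm_square mult.commute of_real_1 power_one)
    then have "cnj \<zeta> = 1 / \<zeta>" using nz by (simp add: field_simps)
    then show "f \<zeta> / \<zeta> ^ Suc k * \<zeta> = f \<zeta> * cnj \<zeta> ^ k" using nz by (simp add: power_one_over)
  qed simp
qed

lemma taylor_coeff_eq_fps_nth: "f has_fps_expansion F \<Longrightarrow> taylor_coeff f n = fps_nth F n"
  by (simp add: taylor_coeff_def fps_nth_fps_expansion)

text \<open>Cauchy product with a geometric series. The value is the conjugate of
  \<open>conj_toeplitz_monomial u k w\<close>: multiplication by u, moved across the inner product
  with z^k, becomes the Toeplitz operator with symbol \<open>cnj u\<close>.\<close>

lemma taylor_coeff_szego_mult: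
  assumes "u holomorphic_on ball 0 1"
  shows "taylor_coeff (\<lambda>\<zeta>. u \<zeta> * (1 / (1 - \<zeta> * cnj w))) k = (\<Sum>m\<le>k. taylor_coeff u m * cnj w ^ (k - m))"
proof -
  obtain U where U: "u has_fps_expansion U" using assms has_fps_expansion_fps_expansion[of "ball 0 1" u] by auto
  have "(\<lambda>\<zeta>. u \<zeta> * inverse (1 - \<zeta> * cnj w)) has_fps_expansion U * inverse (1 - fps_X * fps_const (cnj w))"
    by (intro fps_expansion_intros U) auto
  moreover have "inverse (1 - fps_X * fps_const (cnj w)) = Abs_fps (\<lambda>n. cnj w ^ n)"
  proof -
    have "(1 - fps_X * fps_const (cnj w)) * Abs_fps (\<lambda>n. cnj w ^ n) = 1"
    proof (rule fps_ext)
      fix n show "fps_nth ((1 - fps_X * fps_const (cnj w)) * Abs_fps (\<lambda>n. cnj w ^ n)) n = fps_nth 1 n"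
        by (cases n) (simp_all add: left_diff_distrib mult.assoc)
    qed
    then show ?thesis by (metis fps_inverse_unique)
  qed
  ultimately have "(\<lambda>\<zeta>. u \<zeta> * (1 / (1 - \<zeta> * cnj w))) has_fps_expansion U * Abs_fps (\<lambda>n. cnj w ^ n)"
    by (simp add: divide_inverse)
  from taylor_coeff_eq_fps_nth[OF this, of k] taylor_coeff_eq_fps_nth[OF U] show ?thesis
    by (simp add: fps_mult_nth atLeast0AtMost)
qed

lemma taylor_coeff_dilate:
  assumes "u holomorphic_on ball 0 1" "0 < r" "r < 1"
  shows "taylor_coeff (\<lambda>z. u (of_real r * z)) k = of_real r ^ k * taylor_coeff u k"
proof -
  have "(deriv ^^ k) (\<lambda>w. u (of_real r * w)) 0 = of_real r ^ k * (deriv ^^ k) u (of_real r * 0)"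
    by (rule higher_deriv_compose_linear[OF assms(1), of "ball 0 1"])
       (use assms in \<open>auto simp: norm_mult intro: le_less_trans[OF mult_left_le_one_le]\<close>)
  then show ?thesis by (simp add: taylor_coeff_def)
qed

section \<open>Co-analytic Toeplitz operators and the kernel\<close>

text \<open>The nodes \<open>z i\<close> may coincide. This covers the lists of points in
  \<open>Hb_bound\<close> and, with \<open>z\<close> the identity, finite sets of points.\<close>

definition dBR_form :: "(complex \<Rightarrow> complex) \<Rightarrow> 'i set \<Rightarrow> ('i \<Rightarrow> complex) \<Rightarrow> ('i \<Rightarrow> complex) \<Rightarrow> real" where
  "dBR_form b I z c = Re (\<Sum>i\<in>I. \<Sum>j\<in>I. cnj (c i) * c j * dBR_kernel b (z i) (z j))"

text \<open>The image of \<open>z\<^sup>k\<close> under the Toeplitz operator with symbol \<open>cnj u\<close>.\<close>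

definition conj_toeplitz_monomial :: "(complex \<Rightarrow> complex) \<Rightarrow> nat \<Rightarrow> complex \<Rightarrow> complex" where
  "conj_toeplitz_monomial u k w = (\<Sum>m\<le>k. cnj (taylor_coeff u m) * w ^ (k - m))"

lemma szego_denominator_nonzero:
  fixes z w :: complex
  assumes "norm z \<le> 1" "norm w < 1"
  shows "1 - z * cnj w \<noteq> 0"
proof
  assume "1 - z * cnj w = 0"
  then have "norm z * norm w = 1" by (metis complex_mod_cnj norm_mult norm_one right_minus_eq)
  moreover have "norm z * norm w \<le> norm w" using assms by (simp add: mult_left_le_one_le)
  ultimately show False using assms by linarith
qed

text \<open>Cauchy-Schwarz for the contractive row with entries b and u bounds the square of |b G +
  u t| by |G|^2 + |t|^2; the product with x is then split by 2 s |x| <= s^2 + |x|^2.\<close>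

lemma row_contraction_ineq:
  fixes b u G t x :: complex
  assumes "(norm b)\<^sup>2 + (norm u)\<^sup>2 \<le> 1"
  shows "2 * Re ((b * G + u * t) * x) \<le> (norm x)\<^sup>2 + (norm G)\<^sup>2 + (norm t)\<^sup>2"
proof -
  define s where "s = norm b * norm G + norm u * norm t"
  have "norm (b * G + u * t) \<le> s"
    unfolding s_def norm_mult[symmetric] by (rule norm_triangle_ineq)
  then have "norm ((b * G + u * t) * x) \<le> s * norm x"
    unfolding norm_mult[of _ x] by (intro mult_right_mono) auto
  then have 1: "Re ((b * G + u * t) * x) \<le> s * norm x"
    using complex_Re_le_cmod order_trans by blast
  have 2: "2 * (s * norm x) \<le> s\<^sup>2 + (norm x)\<^sup>2"
    using sum_squares_bound[of s "norm x"] by (simp only: mult.assoc)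
  have "((norm b)\<^sup>2 + (norm u)\<^sup>2) * ((norm G)\<^sup>2 + (norm t)\<^sup>2) - s\<^sup>2 = (norm b * norm t - norm u * norm G)\<^sup>2"
    by (simp add: s_def power2_eq_square algebra_simps)
  then have 3: "s\<^sup>2 \<le> ((norm b)\<^sup>2 + (norm u)\<^sup>2) * ((norm G)\<^sup>2 + (norm t)\<^sup>2)"
    by (metis diff_ge_0_iff_ge zero_le_power2)
  also have "\<dots> \<le> 1 * ((norm G)\<^sup>2 + (norm t)\<^sup>2)" by (intro mult_right_mono assms) auto
  finally have 4: "s\<^sup>2 \<le> (norm G)\<^sup>2 + (norm t)\<^sup>2" by simp
  have "2 * Re ((b * G + u * t) * x) \<le> 2 * (s * norm x)" using 1 by (intro mult_left_mono) auto
  also note 2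
  finally show ?thesis using 4 by simp
qed

text \<open>With F the combination of the Szego kernels at the points \<open>z i\<close> with
  coefficients \<open>c i\<close>, the right side is ||F||^2 - ||T_b^* F||^2 in H^2, and the left
  side is the squared modulus of the inner product of T_u^* z^k with F. Continuity up to the circle
  makes every inner product a mean.\<close>

lemma conj_toeplitz_monomial_form_le_closed:
  assumes "finite I" and z: "\<And>i. i \<in> I \<Longrightarrow> z i \<in> ball 0 1"
    and b: "continuous_on (cball 0 1) b" "b holomorphic_on ball 0 1"
    and u: "continuous_on (cball 0 1) u" "u holomorphic_on ball 0 1"
    and bu: "\<And>\<zeta>. norm \<zeta> = 1 \<Longrightarrow> (norm (b \<zeta>))\<^sup>2 + (norm (u \<zeta>))\<^sup>2 \<le> 1"
  shows "(norm (\<Sum>i\<in>I. cnj (c i) * conj_toeplitz_monomial u k (z i)))\<^sup>2 \<le> dBR_form b I z c"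
proof -
  define S where "S w = (\<lambda>\<zeta>::complex. 1 / (1 - \<zeta> * cnj w))" for w
  define \<beta> where "\<beta> = (\<Sum>i\<in>I. cnj (c i) * conj_toeplitz_monomial u k (z i))"
  define comb where "comb a = (\<lambda>\<zeta>. \<Sum>i\<in>I. a i * S (z i) \<zeta>)" for a
  define F where "F = comb c"
  \<comment> \<open>This is T_b^* F, because T_b^* multiplies the Szego kernel at w by
    \<open>cnj (b w)\<close>.\<close>
  define G where "G = comb (\<lambda>i. c i * cnj (b (z i)))"
  have nz: "1 - \<zeta> * cnj (z i) \<noteq> 0" if "i \<in> I" "norm \<zeta> \<le> 1" for i \<zeta>
    using szego_denominator_nonzero that z by auto
  have Sc: "continuous_on (cball 0 1) (S (z i))" and Sh: "S (z i) holomorphic_on ball 0 1" if "i \<in> I" for i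
    unfolding S_def using nz that by (auto intro!: continuous_intros holomorphic_intros)
  have cc: "continuous_on (cball 0 1) (comb a)" and ch: "comb a holomorphic_on ball 0 1" for a
    unfolding comb_def by (auto intro!: continuous_intros holomorphic_intros Sc Sh)
  have repr: "has_circle_mean (\<lambda>\<zeta>. f \<zeta> * cnj (comb a \<zeta>)) (\<Sum>i\<in>I. cnj (a i) * f (z i))"
    if "continuous_on (cball 0 1) f" "f holomorphic_on ball 0 1" for f a
  proof -
    have "has_circle_mean (\<lambda>\<zeta>. \<Sum>i\<in>I. cnj (a i) * (f \<zeta> * cnj (S (z i) \<zeta>))) (\<Sum>i\<in>I. cnj (a i) * f (z i))"
      unfolding S_def
      by (intro has_circle_mean_sum has_circle_mean_cmult has_circle_mean_szego that \<open>finite I\<close> z)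
    then show ?thesis by (simp add: comb_def sum_distrib_left mult_ac)
  qed
  have M1: "has_circle_mean (\<lambda>\<zeta>. F \<zeta> * cnj (F \<zeta>)) (\<Sum>i\<in>I. cnj (c i) * F (z i))"
    unfolding F_def by (intro repr cc ch)
  have M2: "has_circle_mean (\<lambda>\<zeta>. G \<zeta> * cnj (G \<zeta>)) (\<Sum>i\<in>I. cnj (c i * cnj (b (z i))) * G (z i))"
    unfolding G_def by (intro repr cc ch)
  have M3: "has_circle_mean (\<lambda>\<zeta>. (b \<zeta> * G \<zeta>) * cnj (F \<zeta>)) (\<Sum>i\<in>I. cnj (c i) * (b (z i) * G (z i)))"
    unfolding F_def G_def by (intro repr continuous_on_mult holomorphic_on_mult cc ch b)
  have M4: "has_circle_mean (\<lambda>\<zeta>. u \<zeta> * F \<zeta> * cnj \<zeta> ^ k) (cnj \<beta>)"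
  proof -
    have "has_circle_mean (\<lambda>\<zeta>. \<Sum>i\<in>I. c i * ((u \<zeta> * S (z i) \<zeta>) * cnj \<zeta> ^ k))
        (\<Sum>i\<in>I. c i * taylor_coeff (\<lambda>\<zeta>. u \<zeta> * S (z i) \<zeta>) k)"
      by (intro has_circle_mean_sum has_circle_mean_cmult has_circle_mean_taylor_coeff
          continuous_on_mult holomorphic_on_mult Sc Sh u \<open>finite I\<close>)
    moreover have "(\<Sum>i\<in>I. c i * taylor_coeff (\<lambda>\<zeta>. u \<zeta> * S (z i) \<zeta>) k) = cnj \<beta>"
      unfolding S_def \<beta>_def taylor_coeff_szego_mult[OF u(2)] conj_toeplitz_monomial_def by simp
    ultimately show ?thesis
      by (simp add: F_def comb_def sum_distrib_left sum_distrib_right mult_ac)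
  qed
  \<comment> \<open>\<open>J\<close> is nonnegative on the circle because the row \<open>(b, cnj u)\<close> is contractive there, while its mean is computed by the reproducing property.\<close>
  define J where "J = (\<lambda>\<zeta>. F \<zeta> * cnj (F \<zeta>) + G \<zeta> * cnj (G \<zeta>) - 2 * ((b \<zeta> * G \<zeta>) * cnj (F \<zeta>))
      + \<beta> * cnj \<beta> - (2 * \<beta>) * (u \<zeta> * F \<zeta> * cnj \<zeta> ^ k))"
  define Q where "Q = (\<Sum>i\<in>I. \<Sum>j\<in>I. cnj (c i) * c j * dBR_kernel b (z i) (z j))"
  \<comment> \<open>The mean of b G \<open>cnj F\<close> is again ||G||^2, so the first three terms
    give ||F||^2 - ||G||^2. The coefficient \<open>\<beta>\<close> in front of the last term of
    \<open>J\<close> is chosen so that |beta|^2 - 2 |beta|^2 leaves the desired -|beta|^2.\<close>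
  have "has_circle_mean J ((\<Sum>i\<in>I. cnj (c i) * F (z i)) + (\<Sum>i\<in>I. cnj (c i * cnj (b (z i))) * G (z i))
      - 2 * (\<Sum>i\<in>I. cnj (c i) * (b (z i) * G (z i))) + \<beta> * cnj \<beta> - (2 * \<beta>) * cnj \<beta>)"
    unfolding J_def
    by (intro has_circle_mean_add has_circle_mean_diff has_circle_mean_cmult has_circle_mean_const M1 M2 M3 M4)
  moreover have "(\<Sum>i\<in>I. cnj (c i) * F (z i)) + (\<Sum>i\<in>I. cnj (c i * cnj (b (z i))) * G (z i))
      - 2 * (\<Sum>i\<in>I. cnj (c i) * (b (z i) * G (z i))) + \<beta> * cnj \<beta> - (2 * \<beta>) * cnj \<beta> = Q - \<beta> * cnj \<beta>"
  proof -
    have "Q = (\<Sum>i\<in>I. cnj (c i) * F (z i)) - (\<Sum>i\<in>I. cnj (c i) * (b (z i) * G (z i)))"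
      unfolding Q_def F_def G_def comb_def S_def dBR_kernel_def sum_subtractf[symmetric] sum_distrib_left
      by (intro sum.cong refl) (simp add: diff_divide_distrib algebra_simps)
    then show ?thesis by (simp add: algebra_simps)
  qed
  ultimately have "has_circle_mean J (Q - \<beta> * cnj \<beta>)" by simp
  moreover have "Re (J \<zeta>) \<ge> 0" if "norm \<zeta> = 1" for \<zeta>
  proof -
    define X where "X = u \<zeta> * (\<beta> * cnj \<zeta> ^ k) * F \<zeta>"
    have "2 * Re ((b \<zeta> * G \<zeta> + cnj (u \<zeta>) * cnj (\<beta> * cnj \<zeta> ^ k)) * cnj (F \<zeta>))
        \<le> (norm (cnj (F \<zeta>)))\<^sup>2 + (norm (G \<zeta>))\<^sup>2 + (norm (cnj (\<beta> * cnj \<zeta> ^ k)))\<^sup>2"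
      by (rule row_contraction_ineq) (use bu[OF that] in simp)
    also have "(b \<zeta> * G \<zeta> + cnj (u \<zeta>) * cnj (\<beta> * cnj \<zeta> ^ k)) * cnj (F \<zeta>) = b \<zeta> * G \<zeta> * cnj (F \<zeta>) + cnj X"
      by (simp add: X_def algebra_simps)
    also have "norm (cnj (\<beta> * cnj \<zeta> ^ k)) = norm \<beta>" using that by (simp add: norm_mult norm_power)
    finally have *: "2 * (Re (b \<zeta> * G \<zeta> * cnj (F \<zeta>)) + Re X) \<le> (norm (F \<zeta>))\<^sup>2 + (norm (G \<zeta>))\<^sup>2 + (norm \<beta>)\<^sup>2"
      by simp
    have "J \<zeta> = of_real ((norm (F \<zeta>))\<^sup>2 + (norm (G \<zeta>))\<^sup>2 + (norm \<beta>)\<^sup>2) - 2 * (b \<zeta> * G \<zeta> * cnj (F \<zeta>) + X)"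
      unfolding J_def X_def of_real_add complex_norm_square by (simp add: algebra_simps)
    then have "Re (J \<zeta>) = (norm (F \<zeta>))\<^sup>2 + (norm (G \<zeta>))\<^sup>2 + (norm \<beta>)\<^sup>2 - 2 * (Re (b \<zeta> * G \<zeta> * cnj (F \<zeta>)) + Re X)"
      by (simp only: minus_complex.sel Re_complex_of_real) simp
    then show ?thesis using * by linarith
  qed
  ultimately have "Re (Q - \<beta> * cnj \<beta>) \<ge> 0" by (rule has_circle_mean_nonneg)
  then show ?thesis
    unfolding dBR_form_def Q_def[symmetric] \<beta>_def[symmetric]
    by (simp add: complex_mult_cnj cmod_power2)
qed

text \<open>Boundary values are avoided by dilating \<open>b\<close> and \<open>u\<close> and letting the radius tend to 1.\<close>

lemma conj_toeplitz_monomial_form_le: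
  assumes "finite I" and z: "\<And>i. i \<in> I \<Longrightarrow> z i \<in> ball 0 1"
    and b: "b holomorphic_on ball 0 1" and u: "u holomorphic_on ball 0 1"
    and bu: "\<And>\<zeta>. \<zeta> \<in> ball 0 1 \<Longrightarrow> (norm (b \<zeta>))\<^sup>2 + (norm (u \<zeta>))\<^sup>2 \<le> 1"
  shows "(norm (\<Sum>i\<in>I. cnj (c i) * conj_toeplitz_monomial u k (z i)))\<^sup>2 \<le> dBR_form b I z c"
proof (rule tendsto_le)
  let ?d = "\<lambda>f r (\<zeta>::complex). f (of_real r * \<zeta>) :: complex"
  show "at_left (1::real) \<noteq> bot" by simp
  have lim: "((\<lambda>r. ?d f r w) \<longlongrightarrow> f w) (at_left 1)" if "f holomorphic_on ball 0 1" "w \<in> ball 0 1" for f w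
  proof -
    have "isCont f w" using that by (meson holomorphic_on_imp_continuous_on continuous_on_eq_continuous_at open_ball)
    moreover have "((\<lambda>r::real. of_real r * w) \<longlongrightarrow> of_real 1 * w) (at_left 1)" by (intro tendsto_intros)
    ultimately show ?thesis by (metis isCont_tendsto_compose mult_1 of_real_1)
  qed
  show "((\<lambda>r. dBR_form (?d b r) I z c) \<longlongrightarrow> dBR_form b I z c) (at_left 1)"
    unfolding dBR_form_def dBR_kernel_def divide_inverse
    by (intro tendsto_Re tendsto_sum tendsto_mult tendsto_diff tendsto_const tendsto_cnj lim b z)
  have tay: "\<forall>\<^sub>F r in at_left 1. (\<forall>m. taylor_coeff (?d u r) m = of_real r ^ m * taylor_coeff u m) \<and> 0 < r \<and> r < 1"
    using eventually_at_left_real[OF zero_less_one]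
    by eventually_elim (simp add: taylor_coeff_dilate[OF u])
  have "((\<lambda>r. (norm (\<Sum>i\<in>I. cnj (c i) * (\<Sum>m\<le>k. cnj (of_real r ^ m * taylor_coeff u m) * z i ^ (k - m))))\<^sup>2) \<longlongrightarrow>
      (norm (\<Sum>i\<in>I. cnj (c i) * (\<Sum>m\<le>k. cnj (of_real 1 ^ m * taylor_coeff u m) * z i ^ (k - m))))\<^sup>2) (at_left 1)"
    by (intro tendsto_intros)
  then show "((\<lambda>r. (norm (\<Sum>i\<in>I. cnj (c i) * conj_toeplitz_monomial (?d u r) k (z i)))\<^sup>2) \<longlongrightarrow>
      (norm (\<Sum>i\<in>I. cnj (c i) * conj_toeplitz_monomial u k (z i)))\<^sup>2) (at_left 1)"
  proof (rule Lim_transform_eventually[THEN tendsto_eq_rhs])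
    show "\<forall>\<^sub>F r in at_left 1. (norm (\<Sum>i\<in>I. cnj (c i) * (\<Sum>m\<le>k. cnj (of_real r ^ m * taylor_coeff u m) * z i ^ (k - m))))\<^sup>2 =
        (norm (\<Sum>i\<in>I. cnj (c i) * conj_toeplitz_monomial (?d u r) k (z i)))\<^sup>2"
      using tay by eventually_elim (simp add: conj_toeplitz_monomial_def)
  qed (simp add: conj_toeplitz_monomial_def)
  show "\<forall>\<^sub>F r in at_left 1. (norm (\<Sum>i\<in>I. cnj (c i) * conj_toeplitz_monomial (?d u r) k (z i)))\<^sup>2 \<le> dBR_form (?d b r) I z c"
    using tay
  proof eventually_elim
    case (elim r)
    have sub: "of_real r * \<zeta> \<in> ball 0 1" if "\<zeta> \<in> cball 0 1" for \<zeta> :: complex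
    proof -
      have "norm (of_real r * \<zeta>) \<le> r" using that elim by (simp add: norm_mult mult_left_le)
      then show ?thesis using elim by simp
    qed
    have cont: "continuous_on (cball 0 1) (?d f r)" "?d f r holomorphic_on ball 0 1" if "f holomorphic_on ball 0 1" for f
    proof -
      show "continuous_on (cball 0 1) (?d f r)"
        by (rule continuous_on_compose2[OF holomorphic_on_imp_continuous_on[OF that]])
           (use sub in \<open>auto intro!: continuous_intros\<close>)
      have "(f \<circ> (\<lambda>\<zeta>. of_real r * \<zeta>)) holomorphic_on ball 0 1"
        by (rule holomorphic_on_compose_gen[OF _ that]) (use sub in \<open>auto intro!: holomorphic_intros\<close>)
      then show "?d f r holomorphic_on ball 0 1" by (simp add: o_def)
    qed
    show ?case
    proof (rule conj_toeplitz_monomial_form_le_closed[OF \<open>finite I\<close> z cont[OF b] cont[OF u]])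
      fix \<zeta> :: complex assume "norm \<zeta> = 1"
      then show "(norm (?d b r \<zeta>))\<^sup>2 + (norm (?d u r \<zeta>))\<^sup>2 \<le> 1" by (intro bu sub) simp
    qed
  qed
qed

section \<open>Uniform boundedness and polarization\<close>

text \<open>Sokal's form of the uniform boundedness principle, stated on a subset of an abelian group since the spaces used below are not types. One of \<open>x + \<xi>\<close>, \<open>x - \<xi>\<close> always makes \<open>\<phi>\<close> at least as large as at \<open>\<xi>\<close>, and steps of size \<open>4\<^sup>-\<^sup>k\<close> leave a tail too small to undo that.\<close>

lemma gliding_hump:
  fixes X :: "'v::ab_group_add set" and N :: "'v \<Rightarrow> real" and \<phi> :: "nat \<Rightarrow> 'v \<Rightarrow> complex"
  assumes X0: "0 \<in> X" and Xadd: "\<And>x y. x \<in> X \<Longrightarrow> y \<in> X \<Longrightarrow> x + y \<in> X"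
    and Xdiff: "\<And>x y. x \<in> X \<Longrightarrow> y \<in> X \<Longrightarrow> x - y \<in> X"
    and Nminus: "\<And>x. x \<in> X \<Longrightarrow> N (- x) = N x"
    and complete: "\<And>x. (\<And>k. x k \<in> X) \<Longrightarrow> (\<And>k. N (x (Suc k) - x k) \<le> (1/4)^k) \<Longrightarrow>
        \<exists>y\<in>X. \<forall>k. N (y - x (Suc k)) \<le> (1/4)^k / 3"
    and add: "\<And>n x y. x \<in> X \<Longrightarrow> y \<in> X \<Longrightarrow> \<phi> n (x + y) = \<phi> n x + \<phi> n y"
    and W0: "\<And>n. W n \<ge> 0"
    and W_bound: "\<And>n x. x \<in> X \<Longrightarrow> norm (\<phi> n x) \<le> W n * N x"
    and W_attained: "\<And>n r. r > 0 \<Longrightarrow> \<exists>\<xi>\<in>X. N \<xi> \<le> r \<and> W n * r / 2 \<le> norm (\<phi> n \<xi>)"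
    and bounded: "\<And>x. x \<in> X \<Longrightarrow> \<exists>B. \<forall>n. norm (\<phi> n x) \<le> B"
  shows "\<exists>B. \<forall>n. W n \<le> B"
proof (rule ccontr)
  assume "\<not> ?thesis"
  \<comment> \<open>The 6 is 1 / (1/2 - 1/3): the k-th step secures half of W times 4^-k, and the
    tail can take back at most a third of it.\<close>
  then have "\<forall>k. \<exists>n. W n > 6 * 4 ^ k * real k" by (simp add: not_le)
  then obtain m where m: "\<And>k. W (m k) > 6 * 4 ^ k * real k" by metis
  have "\<forall>k. \<exists>\<xi>\<in>X. N \<xi> \<le> (1/4)^k \<and> W (m k) * (1/4)^k / 2 \<le> norm (\<phi> (m k) \<xi>)"
    using W_attained by simp
  then obtain \<xi> where \<xi>: "\<And>k. \<xi> k \<in> X" "\<And>k. N (\<xi> k) \<le> (1/4)^k"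
      "\<And>k. W (m k) * (1/4)^k / 2 \<le> norm (\<phi> (m k) (\<xi> k))" by metis
  define x where "x = rec_nat 0 (\<lambda>k y. if norm (\<phi> (m k) (\<xi> k)) \<le> norm (\<phi> (m k) (y + \<xi> k)) then y + \<xi> k else y - \<xi> k)"
  have x0: "x 0 = 0" and xS: "x (Suc k) = (if norm (\<phi> (m k) (\<xi> k)) \<le> norm (\<phi> (m k) (x k + \<xi> k)) then x k + \<xi> k else x k - \<xi> k)" for k
    by (simp_all add: x_def)
  have xX: "x k \<in> X" for k
    by (induction k) (auto simp: x0 xS X0 intro: Xadd Xdiff \<xi>)
  have step: "N (x (Suc k) - x k) \<le> (1/4)^k" for k
    using \<xi>(1,2)[of k] Nminus[of "\<xi> k"] by (simp add: xS)
  have large: "norm (\<phi> (m k) (\<xi> k)) \<le> norm (\<phi> (m k) (x (Suc k)))" for k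
  proof (cases "norm (\<phi> (m k) (\<xi> k)) \<le> norm (\<phi> (m k) (x k + \<xi> k))")
    case False
    let ?a = "\<phi> (m k) (x k)" and ?b = "\<phi> (m k) (\<xi> k)"
    have p: "\<phi> (m k) (x k + \<xi> k) = ?a + ?b" using add xX \<xi> by simp
    have "\<phi> (m k) ((x k - \<xi> k) + \<xi> k) = \<phi> (m k) (x k - \<xi> k) + ?b"
      by (rule add) (auto intro: Xdiff xX \<xi>)
    then have q: "\<phi> (m k) (x k - \<xi> k) = ?a - ?b" by simp
    have "2 * norm ?b = norm ((?a + ?b) - (?a - ?b))" by (simp flip: mult_2 add: norm_mult)
    also have "\<dots> \<le> norm (?a + ?b) + norm (?a - ?b)" by (rule norm_triangle_ineq4)
    finally show ?thesis using False p q by (simp add: xS)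
  qed (simp add: xS)
  obtain y where y: "y \<in> X" "\<And>k. N (y - x (Suc k)) \<le> (1/4)^k / 3"
    using complete[OF xX step] by blast
  obtain B where B: "\<And>n. norm (\<phi> n y) \<le> B" using bounded[OF y(1)] by blast
  have "real k \<le> B" for k
  proof -
    let ?d = "y - x (Suc k)"
    have dX: "?d \<in> X" by (intro Xdiff y xX)
    have "\<phi> (m k) (?d + x (Suc k)) = \<phi> (m k) ?d + \<phi> (m k) (x (Suc k))"
      by (rule add[OF dX xX])
    then have "norm (\<phi> (m k) y) \<ge> norm (\<phi> (m k) (x (Suc k))) - norm (\<phi> (m k) ?d)"
      using norm_diff_ineq[of "\<phi> (m k) (x (Suc k))" "\<phi> (m k) ?d"] by (simp add: add.commute)
    moreover have "norm (\<phi> (m k) ?d) \<le> W (m k) * ((1/4)^k / 3)"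
      using W_bound[OF dX, of "m k"] mult_left_mono[OF y(2)[of k] W0[of "m k"]] by linarith
    ultimately have "norm (\<phi> (m k) y) \<ge> W (m k) * (1/4)^k / 6"
      using large[of k] \<xi>(3)[of k] by simp
    moreover have "W (m k) * (1/4)^k / 6 \<ge> (6 * 4^k * real k) * (1/4)^k / 6"
      using m[of k] by (intro divide_right_mono mult_right_mono) auto
    moreover have "(6 * 4^k * real k) * (1/4)^k / 6 = real k" by (simp add: power_one_over)
    ultimately show ?thesis using B[of "m k"] by linarith
  qed
  then show False using reals_Archimedean2[of B] by (metis not_le)
qed

text \<open>The additive half of the Jordan-von Neumann theorem. The parallelogram law is applied at
  x + y, x - y, x + z and x - z; in the right combination the mixed values at x + (y - z) and x - (y
  - z) cancel.\<close>

lemma polarization_additive: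
  fixes q :: "'v::ab_group_add \<Rightarrow> real"
  assumes Xadd: "\<And>x y. x \<in> X \<Longrightarrow> y \<in> X \<Longrightarrow> x + y \<in> X"
    and Xdiff: "\<And>x y. x \<in> X \<Longrightarrow> y \<in> X \<Longrightarrow> x - y \<in> X"
    and par: "\<And>x y. x \<in> X \<Longrightarrow> y \<in> X \<Longrightarrow> q (x + y) + q (x - y) = 2 * q x + 2 * q y"
    and X: "x \<in> X" "y \<in> X" "z \<in> X"
  shows "q (x + (y + z)) - q (x - (y + z)) = (q (x + y) - q (x - y)) + (q (x + z) - q (x - z))"
proof -
  have 1: "q (x + (y + z)) + q (x + (y - z)) = 2 * q (x + y) + 2 * q z"
    using par[of "x + y" z] X Xadd by (simp add: algebra_simps)
  have 2: "q (x - (y - z)) + q (x - (y + z)) = 2 * q (x - y) + 2 * q z"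
    using par[of "x - y" z] X Xdiff by (simp add: algebra_simps)
  have 3: "q (x + (y + z)) + q (x - (y - z)) = 2 * q (x + z) + 2 * q y"
    using par[of "x + z" y] X Xadd by (simp add: algebra_simps)
  have 4: "q (x + (y - z)) + q (x - (y + z)) = 2 * q (x - z) + 2 * q y"
    using par[of "x - z" y] X Xdiff by (simp add: algebra_simps)
  show ?thesis using 1 2 3 4 by linarith
qed

section \<open>Binomial coefficients and the means\<close>

lemma gbinomial_add_of_nat_pos: "\<alpha> \<ge> 0 \<Longrightarrow> j \<le> n \<Longrightarrow> ((real n + \<alpha>) gchoose j) > 0"
proof -
  assume "\<alpha> \<ge> 0" "j \<le> n"
  then have "(\<Prod>i = 0..<j. real n + \<alpha> - real i) > 0" by (intro prod_pos) auto
  then show ?thesis by (simp only: gbinomial_prod_rev) simp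
qed

text \<open>Trinomial revision. It turns the n-th mean, multiplied by A_n, into a convolution of the
  sequence A with the terms of the Taylor series.\<close>

lemma binomial_quotient_gbinomial:
  assumes "\<alpha> \<ge> 0" "j \<le> n"
  shows "real (n choose j) / ((real n + \<alpha>) gchoose j) * ((real n + \<alpha>) gchoose n) = (real (n - j) + \<alpha>) gchoose (n - j)"
proof -
  have "((real n + \<alpha>) gchoose n) * (real n gchoose j) = ((real n + \<alpha>) gchoose j) * (real n + \<alpha> - real j gchoose (n - j))"
    by (rule gbinomial_trinomial_revision[OF assms(2)])
  moreover have "real n + \<alpha> - real j = real (n - j) + \<alpha>" using assms by simp
  ultimately have "real (n choose j) * ((real n + \<alpha>) gchoose n) = ((real n + \<alpha>) gchoose j) * ((real (n - j) + \<alpha>) gchoose (n - j))"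
    by (simp only: binomial_gbinomial mult.commute)
  then show ?thesis using gbinomial_add_of_nat_pos[OF assms] by simp
qed

text \<open>The ratio of consecutive values is (n + 1 + alpha) / (n + 1), which is at least
  1.\<close>

lemma gbinomial_add_of_nat_mono:
  assumes "\<alpha> \<ge> 0" "k \<le> n"
  shows "((real k + \<alpha>) gchoose k) \<le> (real n + \<alpha>) gchoose n"
  using assms(2)
proof (induction n rule: dec_induct)
  case (step n)
  let ?g = "(real n + \<alpha>) gchoose n" and ?g' = "(real n + \<alpha> + 1) gchoose Suc n"
  have "real (Suc n) * ?g \<le> (real n + \<alpha> + 1) * ?g"
    using gbinomial_add_of_nat_pos[OF assms(1), of n n] assms(1) by (intro mult_right_mono) auto
  also have "\<dots> = real (Suc n) * ?g'"
    using Suc_times_gbinomial[of n "real n + \<alpha>"] by (rule sym)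
  finally have "?g \<le> ?g'" by (rule mult_left_le_imp_le) simp
  also have "real n + \<alpha> + 1 = real (Suc n) + \<alpha>" by simp
  finally show ?case using step by simp
qed simp

text \<open>The product of (1 - x)^(alpha + 1) and (1 - x)^(-alpha - 1) is 1. After negating the
  upper index this is Vandermonde's identity with upper indices adding up to 0.\<close>

lemma gbinomial_convolution_inverse:
  "(\<Sum>k\<le>n. ((-1) ^ (n - k) * ((\<alpha> + 1) gchoose (n - k))) * ((real k + \<alpha>) gchoose k)) = (if n = 0 then 1 else 0)"
proof -
  have A: "((real k + \<alpha>) gchoose k) = (-1) ^ k * ((- \<alpha> - 1) gchoose k)" for k
  proof -
    have "real k - (real k + \<alpha>) - 1 = - \<alpha> - 1" by simp
    then show ?thesis using gbinomial_negated_upper[of "real k + \<alpha>" k] by (simp only:)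
  qed
  have "(\<Sum>k\<le>n. ((-1) ^ (n - k) * ((\<alpha> + 1) gchoose (n - k))) * ((real k + \<alpha>) gchoose k))
      = (\<Sum>k\<le>n. (-1) ^ n * (((- \<alpha> - 1) gchoose k) * ((\<alpha> + 1) gchoose (n - k))))"
  proof (intro sum.cong refl)
    fix k assume "k \<in> {..n}"
    then have "(-1::real) ^ n = (-1) ^ (n - k) * (-1) ^ k" by (simp flip: power_add)
    then show "((-1) ^ (n - k) * ((\<alpha> + 1) gchoose (n - k))) * ((real k + \<alpha>) gchoose k) =
        (-1) ^ n * (((- \<alpha> - 1) gchoose k) * ((\<alpha> + 1) gchoose (n - k)))"
      by (simp only: A mult_ac)
  qed
  also have "\<dots> = (-1) ^ n * ((- \<alpha> - 1 + (\<alpha> + 1)) gchoose n)"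
    unfolding gbinomial_Vandermonde[symmetric] sum_distrib_left by (simp only: atLeast0AtMost)
  also have "- \<alpha> - 1 + (\<alpha> + 1) = 0" by simp
  finally show ?thesis by (cases n) simp_all
qed

text \<open>The limit behind this is 1 / Gamma(-a), which is zero when a is a nonnegative integer;
  hence an upper bound only.\<close>

lemma gbinomial_bigo:
  fixes a :: real
  shows "(\<lambda>n. a gchoose n) \<in> O(\<lambda>n. real n powr (- a - 1))"
proof -
  obtain c where "\<And>n. norm ((a gchoose n) / ((-1)^n / exp ((a+1) * of_real (ln (real n))))) \<le> c"
    using convergent_imp_Bseq[OF convergentI[OF gbinomial_asymptotic[of a]]] by (meson BseqE)
  then have c: "\<bar>a gchoose n\<bar> * exp ((a+1) * ln (real n)) \<le> c" for n
    by (simp add: abs_mult power_abs)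
  show ?thesis
  proof (rule bigoI)
    show "\<forall>\<^sub>F n in sequentially. norm (a gchoose n) \<le> c * norm (real n powr (- a - 1))"
      using eventually_gt_at_top[of 0]
    proof eventually_elim
      case (elim n)
      have "real n powr (- a - 1) = 1 / exp ((a+1) * ln (real n))"
        using elim by (simp add: powr_def exp_minus[symmetric] divide_inverse algebra_simps)
      then show ?case using c[of n] by (simp add: pos_le_divide_eq)
    qed
  qed
qed

text \<open>Negating the upper index replaces n + alpha, up to sign, by the fixed upper index -alpha
  - 1.\<close>

lemma gbinomial_add_of_nat_bigo: "(\<lambda>n. (real n + \<alpha>) gchoose n) \<in> O(\<lambda>n. real n powr \<alpha>)"
proof -
  have "\<bar>(real n + \<alpha>) gchoose n\<bar> = \<bar>(- \<alpha> - 1) gchoose n\<bar>" for n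
  proof -
    have "real n - (real n + \<alpha>) - 1 = - \<alpha> - 1" by simp
    then show ?thesis using gbinomial_negated_upper[of "real n + \<alpha>" n] by (simp add: abs_mult power_abs)
  qed
  then have "(\<lambda>n. (real n + \<alpha>) gchoose n) \<in> O(\<lambda>n. (- \<alpha> - 1) gchoose n)"
    by (intro bigoI[of _ 1]) simp
  then show ?thesis using gbinomial_bigo[of "- \<alpha> - 1"] by (auto intro: landau_o.big_trans)
qed

lemma summable_abs_gbinomial:
  fixes \<alpha> :: real
  assumes "\<alpha> \<ge> 0"
  shows "summable (\<lambda>n. \<bar>(\<alpha> + 1) gchoose n\<bar>)"
proof -
  have "summable (\<lambda>n. norm (real n powr (- (\<alpha> + 1) - 1)))"
    using assms by (simp add: summable_real_powr_iff)
  moreover have "(\<lambda>n. \<bar>(\<alpha> + 1) gchoose n\<bar>) \<in> O(\<lambda>n. real n powr (- (\<alpha> + 1) - 1))"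
    using gbinomial_bigo[of "\<alpha> + 1"] by simp
  ultimately show ?thesis by (rule summable_comparison_test_bigo)
qed

section \<open>Taylor coefficients and the inversion of the means\<close>

lemma taylor_coeff_add:
  assumes "f holomorphic_on ball 0 1" "g holomorphic_on ball 0 1"
  shows "taylor_coeff (\<lambda>z. f z + g z) n = taylor_coeff f n + taylor_coeff g n"
proof -
  have e: "h has_fps_expansion fps_expansion h 0" if "h holomorphic_on ball 0 1" for h
    using that has_fps_expansion_fps_expansion[of "ball 0 1" h] by auto
  show ?thesis
    using taylor_coeff_eq_fps_nth[OF has_fps_expansion_add[OF e[OF assms(1)] e[OF assms(2)]]]
      taylor_coeff_eq_fps_nth[OF e[OF assms(1)]] taylor_coeff_eq_fps_nth[OF e[OF assms(2)]] by simp
qed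

lemma taylor_coeff_cmult:
  assumes "f holomorphic_on ball 0 1"
  shows "taylor_coeff (\<lambda>z. a * f z) n = a * taylor_coeff f n"
proof -
  have e: "f has_fps_expansion fps_expansion f 0"
    using assms has_fps_expansion_fps_expansion[of "ball 0 1" f] by auto
  show ?thesis
    using taylor_coeff_eq_fps_nth[OF has_fps_expansion_cmult_left[OF e, of a]] taylor_coeff_eq_fps_nth[OF e] by simp
qed

lemma taylor_coeff_polynomial:
  "taylor_coeff (\<lambda>z. \<Sum>i\<le>n. a i * z ^ i) k = (if k \<le> n then a k else 0)"
proof -
  have "(\<lambda>z. \<Sum>i\<le>n. a i * z ^ i) has_fps_expansion (\<Sum>i\<le>n. fps_const (a i) * fps_X ^ i)"
    by (intro fps_expansion_intros)
  from taylor_coeff_eq_fps_nth[OF this] show ?thesis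
    by (simp add: fps_sum_nth if_distrib sum.delta cong: if_cong)
qed

lemma taylor_coeff_bound:
  assumes "f holomorphic_on ball 0 1" "\<And>z. norm z \<le> 1/2 \<Longrightarrow> norm (f z) \<le> C"
  shows "norm (taylor_coeff f n) \<le> C * 2 ^ n"
proof -
  have "norm ((deriv ^^ n) f 0) \<le> fact n * C / (1/2) ^ n"
  proof (rule Cauchy_inequality)
    show "f holomorphic_on ball 0 (1/2)" using assms(1) by (rule holomorphic_on_subset) auto
    show "continuous_on (cball 0 (1/2)) f"
      using holomorphic_on_imp_continuous_on[OF assms(1)] by (rule continuous_on_subset) auto
  qed (use assms(2) in auto)
  then show ?thesis by (simp add: taylor_coeff_def norm_divide power_one_over field_simps)
qed

text \<open>Multiplication of the generating function by \<open>(1 - x)\<close> to the power \<open>\<alpha> + 1\<close>.\<close>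

lemma sigma_mean_inversion:
  assumes "\<alpha> \<ge> 0"
  shows "(\<Sum>k\<le>n. of_real (((-1) ^ (n - k) * ((\<alpha> + 1) gchoose (n - k))) * ((real k + \<alpha>) gchoose k)) * sigma_mean \<alpha> k h z)
    = taylor_coeff h n * z ^ n"
proof -
  define D where "D m = (-1) ^ m * ((\<alpha> + 1) gchoose m)" for m
  define A where "A m = (real m + \<alpha>) gchoose m" for m
  define t where "t j = taylor_coeff h j * z ^ j" for j
  have conv: "(\<Sum>i\<le>m. D (m - i) * A i) = (if m = 0 then 1 else 0)" for m
    unfolding D_def A_def by (rule gbinomial_convolution_inverse)
  have sig: "of_real (A k) * sigma_mean \<alpha> k h z = (\<Sum>j\<le>k. of_real (A (k - j)) * t j)" for k
    unfolding sigma_mean_def sum_distrib_left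
  proof (intro sum.cong refl)
    fix j assume "j \<in> {..k}"
    then have "real (k choose j) / ((real k + \<alpha>) gchoose j) * A k = A (k - j)"
      unfolding A_def using binomial_quotient_gbinomial[OF assms] by simp
    then have "of_real (A (k - j)) = (of_real (A k) * of_real (real (k choose j) / ((real k + \<alpha>) gchoose j)) :: complex)"
      by (metis mult.commute of_real_mult)
    then show "of_real (A k) * (of_real (real (k choose j) / ((real k + \<alpha>) gchoose j)) * taylor_coeff h j * z ^ j)
        = of_real (A (k - j)) * t j"
      by (simp only: t_def mult.assoc)
  qed
  \<comment> \<open>Only k between j and n contributes; after the shift i = k - j the sum is the
    inverse convolution at n - j.\<close>
  have inner: "(\<Sum>k\<le>n. if j \<le> k then D (n - k) * A (k - j) else 0) = (if j = n then 1 else 0)" if "j \<le> n" for j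
  proof -
    have "(\<Sum>k\<le>n. if j \<le> k then D (n - k) * A (k - j) else 0) = (\<Sum>k\<in>{j..n}. D (n - k) * A (k - j))"
      by (rule sum.mono_neutral_cong_right) auto
    also have "\<dots> = (\<Sum>i\<le>n - j. D (n - j - i) * A i)"
      by (rule sum.reindex_bij_witness[of _ "\<lambda>i. i + j" "\<lambda>k. k - j"]) (use that in auto)
    also have "\<dots> = (if j = n then 1 else 0)" unfolding conv using that by auto
    finally show ?thesis .
  qed
  have "(\<Sum>k\<le>n. of_real (D (n - k) * A k) * sigma_mean \<alpha> k h z)
      = (\<Sum>k\<le>n. \<Sum>j\<le>k. of_real (D (n - k) * A (k - j)) * t j)"
    by (simp add: mult.assoc sig sum_distrib_left)
  also have "\<dots> = (\<Sum>k\<le>n. \<Sum>j\<le>n. of_real (if j \<le> k then D (n - k) * A (k - j) else 0) * t j)"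
    by (intro sum.cong refl sum.mono_neutral_cong_left) auto
  also have "\<dots> = (\<Sum>j\<le>n. \<Sum>k\<le>n. of_real (if j \<le> k then D (n - k) * A (k - j) else 0) * t j)"
    by (rule sum.swap)
  also have "\<dots> = (\<Sum>j\<le>n. of_real (\<Sum>k\<le>n. if j \<le> k then D (n - k) * A (k - j) else 0) * t j)"
    by (simp only: of_real_sum sum_distrib_right)
  also have "\<dots> = (\<Sum>j\<le>n. if j = n then t j else 0)"
    by (intro sum.cong refl) (simp only: inner atMost_iff, simp)
  also have "\<dots> = t n" by simp
  finally show ?thesis by (simp only: D_def A_def t_def)
qed

text \<open>The odd powers of i contribute purely imaginary terms. What remains is the real
  polarization formula, to which \<open>polarization_additive\<close> applies.\<close>

lemma Re_Hb_inner:
  "Re (Hb_inner b f g) = ((Hb_norm b (\<lambda>z. f z + g z))\<^sup>2 - (Hb_norm b (\<lambda>z. f z - g z))\<^sup>2) / 4"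
proof -
  have "Re (\<Sum>k<(4::nat). \<i> ^ k * of_real ((Hb_norm b (\<lambda>z. f z + \<i> ^ k * g z))\<^sup>2))
     = (Hb_norm b (\<lambda>z. f z + g z))\<^sup>2 - (Hb_norm b (\<lambda>z. f z - g z))\<^sup>2"
    by (simp add: eval_nat_numeral lessThan_Suc del: of_real_power of_real_mult)
  then show ?thesis by (simp add: Hb_inner_def)
qed

section \<open>The Hilbert space\<close>

text \<open>Coefficients at coinciding points are merged, so that finite lists of points can be
  traded for finite sets.\<close>

lemma sum_collapse:
  fixes c :: "'i \<Rightarrow> complex"
  assumes "finite I"
  shows "(\<Sum>w\<in>z ` I. (\<Sum>i\<in>{i\<in>I. z i = w}. c i) * g w) = (\<Sum>i\<in>I. c i * g (z i))"
proof -
  have "(\<Sum>i\<in>I. c i * g (z i)) = (\<Sum>w\<in>z ` I. \<Sum>i\<in>{i\<in>I. z i = w}. c i * g (z i))"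
    by (rule sum.image_gen[OF assms])
  then show ?thesis by (simp add: sum_distrib_right)
qed

text \<open>For f in H(b) this is the inner product of f with the combination of the kernels K(., z)
  with coefficients \<open>c z\<close>; the squared norm of that combination is
  \<open>dBR_form_on b A c\<close>.\<close>

definition kernel_functional :: "complex set \<Rightarrow> (complex \<Rightarrow> complex) \<Rightarrow> (complex \<Rightarrow> complex) \<Rightarrow> complex" where
  "kernel_functional A c f = (\<Sum>z\<in>A. cnj (c z) * f z)"

abbreviation dBR_form_on :: "(complex \<Rightarrow> complex) \<Rightarrow> complex set \<Rightarrow> (complex \<Rightarrow> complex) \<Rightarrow> real" where
  "dBR_form_on b A \<equiv> dBR_form b A (\<lambda>z. z)"

lemma Hb_bound_summand:
  "Re (\<Sum>i\<in>I. \<Sum>k\<in>I. cnj (c i) * c k * ((of_real C)\<^sup>2 * dBR_kernel b (z i) (z k) - f (z i) * cnj (f (z k))))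
    = C\<^sup>2 * dBR_form b I z c - (norm (\<Sum>i\<in>I. cnj (c i) * f (z i)))\<^sup>2"
proof -
  have "(\<Sum>i\<in>I. \<Sum>k\<in>I. cnj (c i) * c k * ((of_real C)\<^sup>2 * dBR_kernel b (z i) (z k) - f (z i) * cnj (f (z k))))
    = of_real (C\<^sup>2) * (\<Sum>i\<in>I. \<Sum>k\<in>I. cnj (c i) * c k * dBR_kernel b (z i) (z k))
      - (\<Sum>i\<in>I. cnj (c i) * f (z i)) * cnj (\<Sum>i\<in>I. cnj (c i) * f (z i))"
    by (simp add: right_diff_distrib sum_subtractf sum_distrib_left sum_product mult_ac)
  then show ?thesis
    by (simp only: dBR_form_def complex_norm_square[symmetric] minus_complex.sel Re_complex_of_real) simp
qed

text \<open>The double sum over f(z) \<open>cnj\<close> f(w) factors into a squared modulus, so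
  positivity of the kernel difference is boundedness by C of the functional that f induces on
  combinations of kernels.\<close>

lemma Hb_bound_iff_square:
  "Hb_bound b f C \<longleftrightarrow> C \<ge> 0 \<and> (\<forall>A c. finite A \<longrightarrow> A \<subseteq> ball 0 1 \<longrightarrow>
      (norm (kernel_functional A c f))\<^sup>2 \<le> C\<^sup>2 * dBR_form_on b A c)"
proof (intro iffI conjI allI impI)
  assume H: "Hb_bound b f C"
  then show "C \<ge> 0" by (simp add: Hb_bound_def)
  fix A c assume A: "finite A" "A \<subseteq> ball (0::complex) 1"
  obtain h where h: "bij_betw h {..<card A} A"
    using ex_bij_betw_nat_finite[OF A(1)] by (auto simp: atLeast0LessThan)
  have hA: "\<forall>i<card A. h i \<in> ball 0 1" using h A(2) by (metis bij_betwE lessThan_iff subsetD)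
  have "Re (\<Sum>i<n. \<Sum>k<n. cnj (cs i) * cs k *
      ((of_real C)\<^sup>2 * dBR_kernel b (zs i) (zs k) - f (zs i) * cnj (f (zs k)))) \<ge> 0"
    if "\<forall>i<n. zs i \<in> ball 0 1" for n :: nat and zs cs
    using H that unfolding Hb_bound_def by blast
  from this[OF hA, of "\<lambda>i. c (h i)"]
  have "Re (\<Sum>i<card A. \<Sum>k<card A. cnj (c (h i)) * c (h k) *
      ((of_real C)\<^sup>2 * dBR_kernel b (h i) (h k) - f (h i) * cnj (f (h k)))) \<ge> 0" .
  then show "(norm (kernel_functional A c f))\<^sup>2 \<le> C\<^sup>2 * dBR_form_on b A c"
    unfolding Hb_bound_summand[where c = "\<lambda>i. c (h i)"] dBR_form_def kernel_functional_def
    by (simp add: sum.reindex_bij_betw[OF h, of "\<lambda>z. cnj (c z) * f z"]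
        sum.reindex_bij_betw[OF h, of "\<lambda>w. cnj (c z) * c w * dBR_kernel b z w" for z]
        sum.reindex_bij_betw[OF h, of "\<lambda>z. \<Sum>w\<in>A. cnj (c z) * c w * dBR_kernel b z w"])
next
  assume H: "C \<ge> 0 \<and> (\<forall>A c. finite A \<longrightarrow> A \<subseteq> ball 0 1 \<longrightarrow>
      (norm (kernel_functional A c f))\<^sup>2 \<le> C\<^sup>2 * dBR_form_on b A c)"
  show "Hb_bound b f C"
    unfolding Hb_bound_def
  proof (intro conjI allI impI)
    show "C \<ge> 0" using H by simp
    fix n :: nat and zs cs :: "nat \<Rightarrow> complex" assume z: "\<forall>i<n. zs i \<in> ball 0 1"
    let ?A = "zs ` {..<n}"
    define c where "c w = (\<Sum>i\<in>{i\<in>{..<n}. zs i = w}. cs i)" for w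
    have c: "(\<Sum>w\<in>?A. c w * g w) = (\<Sum>i<n. cs i * g (zs i))" for g
      unfolding c_def by (rule sum_collapse) simp
    have c': "(\<Sum>w\<in>?A. cnj (c w) * g w) = (\<Sum>i<n. cnj (cs i) * g (zs i))" for g
      unfolding c_def cnj_sum by (rule sum_collapse) simp
    have "(\<Sum>z\<in>?A. \<Sum>w\<in>?A. cnj (c z) * c w * dBR_kernel b z w)
        = (\<Sum>z\<in>?A. cnj (c z) * (\<Sum>w\<in>?A. c w * dBR_kernel b z w))"
      by (simp add: sum_distrib_left mult_ac)
    also have "\<dots> = (\<Sum>i<n. \<Sum>k<n. cnj (cs i) * cs k * dBR_kernel b (zs i) (zs k))"
      unfolding c c' by (simp add: sum_distrib_left mult_ac)
    finally have "dBR_form_on b ?A c = dBR_form b {..<n} zs cs" by (simp add: dBR_form_def)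
    moreover have "(norm (kernel_functional ?A c f))\<^sup>2 \<le> C\<^sup>2 * dBR_form_on b ?A c"
      using H z by (auto simp: image_subset_iff)
    ultimately show "Re (\<Sum>i<n. \<Sum>k<n. cnj (cs i) * cs k *
        ((of_real C)\<^sup>2 * dBR_kernel b (zs i) (zs k) - f (zs i) * cnj (f (zs k)))) \<ge> 0"
      unfolding Hb_bound_summand by (simp add: kernel_functional_def c')
  qed
qed

lemma kernel_functional_comb:
  "kernel_functional A (\<lambda>z. p * c z + q * d z) f = cnj p * kernel_functional A c f + cnj q * kernel_functional A d f"
  by (simp add: kernel_functional_def sum.distrib sum_distrib_left algebra_simps)

lemma kernel_functional_add: "kernel_functional A c (\<lambda>z. f z + g z) = kernel_functional A c f + kernel_functional A c g"
  by (simp add: kernel_functional_def sum.distrib algebra_simps)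

lemma kernel_functional_cmult: "kernel_functional A c (\<lambda>z. a * f z) = a * kernel_functional A c f"
  by (simp add: kernel_functional_def sum_distrib_left algebra_simps)

lemma dBR_form_parallelogram:
  "dBR_form b I z (\<lambda>i. p * c i + q * d i) + dBR_form b I z (\<lambda>i. p * c i - q * d i)
    = 2 * (norm p)\<^sup>2 * dBR_form b I z c + 2 * (norm q)\<^sup>2 * dBR_form b I z d"
proof -
  let ?S = "\<lambda>x y. \<Sum>i\<in>I. \<Sum>k\<in>I. cnj (x i) * y k * dBR_kernel b (z i) (z k)"
  have "?S (\<lambda>i. p * c i + q * d i) (\<lambda>i. p * c i + q * d i) + ?S (\<lambda>i. p * c i - q * d i) (\<lambda>i. p * c i - q * d i)
      = 2 * (p * cnj p) * ?S c c + 2 * (q * cnj q) * ?S d d"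
    by (simp add: sum.distrib[symmetric] sum_distrib_left algebra_simps)
  then have "Re (?S (\<lambda>i. p * c i + q * d i) (\<lambda>i. p * c i + q * d i) + ?S (\<lambda>i. p * c i - q * d i) (\<lambda>i. p * c i - q * d i))
      = Re (of_real (2 * (norm p)\<^sup>2) * ?S c c + of_real (2 * (norm q)\<^sup>2) * ?S d d)"
    unfolding of_real_mult complex_norm_square by (simp only: of_real_numeral)
  then show ?thesis by (simp only: dBR_form_def plus_complex.sel times_complex.sel Re_complex_of_real Im_complex_of_real
        mult_zero_left diff_zero)
qed

text \<open>Extension by zero brings two combinations over different finite sets onto their
  union.\<close>

lemma kernel_functional_extend:
  assumes "finite A" "B \<subseteq> A"
  shows "kernel_functional A (\<lambda>z. if z \<in> B then c z else 0) f = kernel_functional B c f"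
    and "dBR_form_on b A (\<lambda>z. if z \<in> B then c z else 0) = dBR_form_on b B c"
proof -
  have s: "(\<Sum>z\<in>A. (if z \<in> B then g z else 0)) = sum g B" for g :: "complex \<Rightarrow> complex"
    using assms by (simp add: sum.If_cases Int_absorb1)
  have "kernel_functional A (\<lambda>z. if z \<in> B then c z else 0) f = (\<Sum>z\<in>A. if z \<in> B then cnj (c z) * f z else 0)"
    unfolding kernel_functional_def by (intro sum.cong) auto
  then show "kernel_functional A (\<lambda>z. if z \<in> B then c z else 0) f = kernel_functional B c f"
    by (simp only: s kernel_functional_def)
  have "(\<Sum>z\<in>A. \<Sum>w\<in>A. cnj (if z \<in> B then c z else 0) * (if w \<in> B then c w else 0) * dBR_kernel b z w)
      = (\<Sum>z\<in>A. if z \<in> B then (\<Sum>w\<in>A. if w \<in> B then cnj (c z) * c w * dBR_kernel b z w else 0) else 0)"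
    by (intro sum.cong) (auto intro!: sum.neutral sum.cong)
  then show "dBR_form_on b A (\<lambda>z. if z \<in> B then c z else 0) = dBR_form_on b B c"
    by (simp only: s dBR_form_def)
qed

text \<open>What is kept of non-extremality. The function u acts as a substitute for the Pythagorean
  mate of b, with an inequality on the disk in place of |a|^2 + |b|^2 = 1 on the circle.\<close>

locale dBR_symbol =
  fixes b u :: "complex \<Rightarrow> complex"
  assumes b_holo: "b holomorphic_on ball 0 1"
    and u_holo: "u holomorphic_on ball 0 1"
    and column_contraction: "z \<in> ball 0 1 \<Longrightarrow> (norm (b z))\<^sup>2 + (norm (u z))\<^sup>2 \<le> 1"
    and u_nonzero: "\<exists>z\<in>ball 0 1. u z \<noteq> 0"
begin

section \<open>The norm of H(b) as a dual norm, and its parallelogram law\<close>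

definition comb_norm where "comb_norm A c = sqrt (dBR_form_on b A c)"

lemma form_ge_square:
  assumes "finite A" "A \<subseteq> ball 0 1"
  shows "(norm (kernel_functional A c (conj_toeplitz_monomial u k)))\<^sup>2 \<le> dBR_form_on b A c"
  unfolding kernel_functional_def
  by (rule conj_toeplitz_monomial_form_le) (use assms b_holo u_holo column_contraction in auto)

text \<open>Positivity of the kernel comes as a by-product of the Toeplitz estimate, since the form
  dominates a square.\<close>

lemma form_nonneg: "finite A \<Longrightarrow> A \<subseteq> ball 0 1 \<Longrightarrow> dBR_form_on b A c \<ge> 0"
  using form_ge_square order_trans zero_le_power2 by blast

lemma Hb_bound_iff:
  "Hb_bound b f C \<longleftrightarrow> C \<ge> 0 \<and> (\<forall>A c. finite A \<longrightarrow> A \<subseteq> ball 0 1 \<longrightarrow> norm (kernel_functional A c f) \<le> C * comb_norm A c)"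
proof -
  have "(norm (kernel_functional A c f))\<^sup>2 \<le> C\<^sup>2 * dBR_form_on b A c \<longleftrightarrow> norm (kernel_functional A c f) \<le> C * comb_norm A c"
    if "C \<ge> 0" "finite A" "A \<subseteq> ball 0 1" for A c
  proof -
    have "norm (kernel_functional A c f) \<le> C * comb_norm A c \<longleftrightarrow> (norm (kernel_functional A c f))\<^sup>2 \<le> (C * comb_norm A c)\<^sup>2"
      using that form_nonneg[OF that(2,3)] by (subst power2_le_iff_abs_le) (auto simp: comb_norm_def abs_mult)
    then show ?thesis using form_nonneg[OF that(2,3)] by (simp add: comb_norm_def power_mult_distrib)
  qed
  then show ?thesis unfolding Hb_bound_iff_square by blast
qed

lemma comb_norm_nonneg: "finite A \<Longrightarrow> A \<subseteq> ball 0 1 \<Longrightarrow> comb_norm A c \<ge> 0"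
  by (simp add: comb_norm_def form_nonneg)

lemma Hb_boundD: "Hb_bound b f C \<Longrightarrow> finite A \<Longrightarrow> A \<subseteq> ball 0 1 \<Longrightarrow> norm (kernel_functional A c f) \<le> C * comb_norm A c"
  and Hb_bound_nonneg: "Hb_bound b f C \<Longrightarrow> C \<ge> 0"
  by (auto simp: Hb_bound_iff)

lemma Hb_bound_mono:
  assumes "Hb_bound b f C" "C \<le> D"
  shows "Hb_bound b f D"
  using assms unfolding Hb_bound_iff
  by (auto intro: order_trans[OF _ mult_right_mono] comb_norm_nonneg)

lemma Hb_bound_add: "Hb_bound b f C \<Longrightarrow> Hb_bound b g D \<Longrightarrow> Hb_bound b (\<lambda>z. f z + g z) (C + D)"
  unfolding Hb_bound_iff kernel_functional_add
  by (auto simp: distrib_right intro!: order_trans[OF norm_triangle_ineq] add_mono)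

lemma Hb_bound_cmult: "Hb_bound b f C \<Longrightarrow> Hb_bound b (\<lambda>z. a * f z) (norm a * C)"
  unfolding Hb_bound_iff kernel_functional_cmult by (auto simp: norm_mult mult.assoc intro!: mult_left_mono)

lemma Hb_bound_zero: "Hb_bound b (\<lambda>z. 0) 0"
  by (simp add: Hb_bound_iff kernel_functional_def)

lemma Hb_bound_diff:
  assumes "Hb_bound b f C" "Hb_bound b g D"
  shows "Hb_bound b (\<lambda>z. f z - g z) (C + D)"
  using Hb_bound_add[OF assms(1) Hb_bound_cmult[OF assms(2), of "-1"]] by simp

text \<open>Each inequality behind \<open>Hb_bound\<close> involves finitely many points, so it
  survives pointwise limits.\<close>

lemma Hb_bound_limit:
  assumes "\<And>z. z \<in> ball 0 1 \<Longrightarrow> (\<lambda>n. f n z) \<longlonglongrightarrow> g z" "\<forall>\<^sub>F n in sequentially. Hb_bound b (f n) C"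
  shows "Hb_bound b g C"
  unfolding Hb_bound_iff
proof (intro conjI allI impI)
  show "C \<ge> 0" using eventually_happens[OF assms(2)] Hb_bound_nonneg by auto
  fix A c assume A: "finite A" "A \<subseteq> ball (0::complex) 1"
  have "(\<lambda>n. norm (kernel_functional A c (f n))) \<longlonglongrightarrow> norm (kernel_functional A c g)"
    unfolding kernel_functional_def using A by (intro tendsto_intros assms(1)) auto
  then show "norm (kernel_functional A c g) \<le> C * comb_norm A c"
    by (rule tendsto_upperbound) (use assms(2) in \<open>auto elim!: eventually_mono intro!: Hb_boundD[OF _ A]\<close>)
qed

text \<open>The functional is tested on a single point, where K(z,z) <= 1 / (1 - |z|^2).\<close>

lemma Hb_bound_pointwise:
  assumes "Hb_bound b f C" "norm z \<le> \<rho>" "\<rho> < 1"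
  shows "norm (f z) \<le> C / sqrt (1 - \<rho>\<^sup>2)"
proof -
  have z: "norm z < 1" using assms by simp
  have sq: "(norm z)\<^sup>2 < 1" "(norm z)\<^sup>2 \<le> \<rho>\<^sup>2" "\<rho>\<^sup>2 < 1"
    using assms z by (auto simp: abs_square_less_1 intro!: power_mono) (smt (verit) norm_ge_zero power2_less_1_iff abs_square_less_1)
  have "dBR_kernel b z z = of_real ((1 - (norm (b z))\<^sup>2) / (1 - (norm z)\<^sup>2))"
    by (simp add: dBR_kernel_def complex_norm_square[symmetric])
  then have "dBR_form_on b {z} (\<lambda>_. 1) = (1 - (norm (b z))\<^sup>2) / (1 - (norm z)\<^sup>2)"
    by (simp add: dBR_form_def)
  also have "\<dots> \<le> 1 / (1 - \<rho>\<^sup>2)" using sq by (intro frac_le) auto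
  finally have "comb_norm {z} (\<lambda>_. 1) \<le> 1 / sqrt (1 - \<rho>\<^sup>2)"
    unfolding comb_norm_def by (metis real_sqrt_divide real_sqrt_le_mono real_sqrt_one)
  moreover have "norm (f z) \<le> C * comb_norm {z} (\<lambda>_. 1)"
    using Hb_boundD[OF assms(1), of "{z}" "\<lambda>_. 1"] z by (simp add: kernel_functional_def)
  ultimately show ?thesis
    using mult_left_mono[OF _ Hb_bound_nonneg[OF assms(1)]] by (fastforce intro: order_trans)
qed

lemma Hb_norm_le: "Hb_bound b f C \<Longrightarrow> Hb_norm b f \<le> C"
  unfolding Hb_norm_def by (rule cInf_lower) (auto simp: bdd_below_def intro: Hb_bound_nonneg)

text \<open>Each test is a closed condition on C, so the infimum is attained. If
  \<open>comb_norm A c\<close> is 0 the test is the same for every C.\<close>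

lemma Hb_bound_Hb_norm:
  assumes "in_Hb b f"
  shows "Hb_bound b f (Hb_norm b f)"
proof -
  have ne: "{C. Hb_bound b f C} \<noteq> {}" using assms by (auto simp: in_Hb_def)
  show ?thesis
    unfolding Hb_bound_iff
  proof (intro conjI allI impI)
    show "Hb_norm b f \<ge> 0" unfolding Hb_norm_def by (rule cInf_greatest[OF ne]) (auto intro: Hb_bound_nonneg)
    fix A c assume A: "finite A" "A \<subseteq> ball (0::complex) 1"
    show "norm (kernel_functional A c f) \<le> Hb_norm b f * comb_norm A c"
    proof (cases "comb_norm A c = 0")
      case True
      then show ?thesis using ne Hb_boundD[OF _ A, of f _ c] by auto
    next
      case False
      then have p: "comb_norm A c > 0" using comb_norm_nonneg[OF A, of c] by simp
      have "norm (kernel_functional A c f) / comb_norm A c \<le> Hb_norm b f"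
        unfolding Hb_norm_def using Hb_boundD[OF _ A, of f _ c] p
        by (intro cInf_greatest[OF ne]) (auto simp: pos_divide_le_eq)
      then show ?thesis using p by (simp add: pos_divide_le_eq)
    qed
  qed
qed

lemma Hb_norm_nonneg: "in_Hb b f \<Longrightarrow> Hb_norm b f \<ge> 0"
  using Hb_bound_Hb_norm Hb_bound_nonneg by blast

lemma in_HbI: "Hb_bound b f C \<Longrightarrow> in_Hb b f"
  by (auto simp: in_Hb_def)

lemma in_Hb_add: "in_Hb b f \<Longrightarrow> in_Hb b g \<Longrightarrow> in_Hb b (\<lambda>z. f z + g z)"
  and in_Hb_diff: "in_Hb b f \<Longrightarrow> in_Hb b g \<Longrightarrow> in_Hb b (\<lambda>z. f z - g z)"
  and in_Hb_cmult: "in_Hb b f \<Longrightarrow> in_Hb b (\<lambda>z. a * f z)"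
  and in_Hb_zero: "in_Hb b (\<lambda>z. 0)"
  unfolding in_Hb_def using Hb_bound_add Hb_bound_diff Hb_bound_cmult Hb_bound_zero by blast+

lemma Hb_norm_triangle:
  assumes "in_Hb b f" "in_Hb b g"
  shows "Hb_norm b (\<lambda>z. f z + g z) \<le> Hb_norm b f + Hb_norm b g"
  by (intro Hb_norm_le Hb_bound_add Hb_bound_Hb_norm assms)

lemma Hb_norm_cmult:
  assumes "in_Hb b f"
  shows "Hb_norm b (\<lambda>z. a * f z) = norm a * Hb_norm b f"
proof (rule antisym)
  show le: "Hb_norm b (\<lambda>z. a * f z) \<le> norm a * Hb_norm b f"
    by (intro Hb_norm_le Hb_bound_cmult Hb_bound_Hb_norm assms)
  show "norm a * Hb_norm b f \<le> Hb_norm b (\<lambda>z. a * f z)"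
  proof (cases "a = 0")
    case True
    then show ?thesis using Hb_norm_nonneg[OF in_Hb_zero] by simp
  next
    case False
    have "Hb_bound b (\<lambda>z. inverse a * (a * f z)) (norm (inverse a) * Hb_norm b (\<lambda>z. a * f z))"
      by (intro Hb_bound_cmult Hb_bound_Hb_norm in_Hb_cmult assms)
    then have "Hb_norm b f \<le> norm (inverse a) * Hb_norm b (\<lambda>z. a * f z)"
      using False by (intro Hb_norm_le) (simp flip: mult.assoc)
    then have "norm a * Hb_norm b f \<le> norm a * (norm (inverse a) * Hb_norm b (\<lambda>z. a * f z))"
      by (intro mult_left_mono) auto
    also have "\<dots> = Hb_norm b (\<lambda>z. a * f z)" using False by (simp add: norm_inverse)
    finally show ?thesis .
  qed
qed

lemma Hb_norm_sum:
  assumes "finite I" "\<And>i. i \<in> I \<Longrightarrow> in_Hb b (f i)"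
  shows "in_Hb b (\<lambda>z. \<Sum>i\<in>I. f i z)" "Hb_norm b (\<lambda>z. \<Sum>i\<in>I. f i z) \<le> (\<Sum>i\<in>I. Hb_norm b (f i))"
proof -
  have "Hb_bound b (\<lambda>z. \<Sum>i\<in>I. f i z) (\<Sum>i\<in>I. Hb_norm b (f i))"
    using assms
  proof (induction I rule: finite_induct)
    case empty
    then show ?case by (simp add: Hb_bound_zero)
  next
    case (insert i I)
    then show ?case using Hb_bound_add[of "f i" "Hb_norm b (f i)"] Hb_bound_Hb_norm by simp
  qed
  then show "in_Hb b (\<lambda>z. \<Sum>i\<in>I. f i z)" "Hb_norm b (\<lambda>z. \<Sum>i\<in>I. f i z) \<le> (\<Sum>i\<in>I. Hb_norm b (f i))"
    by (auto intro: in_HbI Hb_norm_le)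
qed

text \<open>\<open>Hb_norm\<close> is the dual norm of the semi-inner product \<open>dBR_form\<close>; the parallelogram law passes to the dual by testing on \<open>X r c \<plusminus> Y p d\<close>.\<close>

lemma parallelogram_functional:
  assumes f: "Hb_bound b f F" and g: "Hb_bound b g G" and A: "finite A" "A \<subseteq> ball 0 1"
  shows "(norm (kernel_functional A c (\<lambda>z. f z + g z)))\<^sup>2 * dBR_form_on b A d
      + (norm (kernel_functional A d (\<lambda>z. f z - g z)))\<^sup>2 * dBR_form_on b A c
      \<le> (2 * F\<^sup>2 + 2 * G\<^sup>2) * (dBR_form_on b A c * dBR_form_on b A d)"
proof -
  define p r where "p = dBR_form_on b A c" and "r = dBR_form_on b A d"
  have pr: "p \<ge> 0" "r \<ge> 0" using form_nonneg[OF A] by (auto simp: p_def r_def)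
  define X Y where "X = kernel_functional A c (\<lambda>z. f z + g z)" and "Y = kernel_functional A d (\<lambda>z. f z - g z)"
  define T where "T = (norm X)\<^sup>2 * r + (norm Y)\<^sup>2 * p"
  have T0: "T \<ge> 0" using pr by (simp add: T_def)
  have Xe: "X = kernel_functional A c f + kernel_functional A c g" by (simp add: X_def kernel_functional_add)
  have Ye: "Y = kernel_functional A d f - kernel_functional A d g"
    unfolding Y_def kernel_functional_def by (simp add: right_diff_distrib sum_subtractf)
  \<comment> \<open>With these weights the functionals of f at \<open>e\<close> and of g at
    \<open>e'\<close> add up to T, while the two forms add up to 2 p r T; hence one factor T cancels
    after squaring.\<close>
  define e where "e = (\<lambda>z. (X * of_real r) * c z + (Y * of_real p) * d z)"
  define e' where "e' = (\<lambda>z. (X * of_real r) * c z - (Y * of_real p) * d z)"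
  have ev: "kernel_functional A e f = cnj (X * of_real r) * kernel_functional A c f + cnj (Y * of_real p) * kernel_functional A d f"
    unfolding e_def by (rule kernel_functional_comb)
  have ev': "kernel_functional A e' g = cnj (X * of_real r) * kernel_functional A c g - cnj (Y * of_real p) * kernel_functional A d g"
    unfolding e'_def using kernel_functional_comb[of A "X * of_real r" c "- (Y * of_real p)" d g] by simp
  have "kernel_functional A e f + kernel_functional A e' g = X * cnj X * of_real r + Y * cnj Y * of_real p"
    unfolding ev ev' Xe Ye by (simp add: algebra_simps)
  also have "\<dots> = of_real T" unfolding T_def of_real_add of_real_mult complex_norm_square by simp
  finally have "T = norm (kernel_functional A e f + kernel_functional A e' g)" using T0 by simp
  also have "\<dots> \<le> norm (kernel_functional A e f) + norm (kernel_functional A e' g)" by (rule norm_triangle_ineq)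
  also have "\<dots> \<le> F * comb_norm A e + G * comb_norm A e'" by (intro add_mono Hb_boundD f g A)
  finally have T1: "T \<le> F * comb_norm A e + G * comb_norm A e'" .
  have sq: "(comb_norm A x)\<^sup>2 = dBR_form_on b A x" for x using form_nonneg[OF A] by (simp add: comb_norm_def)
  have sum2: "(comb_norm A e)\<^sup>2 + (comb_norm A e')\<^sup>2 = 2 * p * r * T"
    unfolding sq e_def e'_def dBR_form_parallelogram
    using pr by (simp add: norm_mult power_mult_distrib T_def p_def[symmetric] r_def[symmetric] power2_eq_square algebra_simps)
  have "T\<^sup>2 \<le> (F * comb_norm A e + G * comb_norm A e')\<^sup>2" using T0 T1 by (intro power_mono)
  also have "\<dots> \<le> (F\<^sup>2 + G\<^sup>2) * ((comb_norm A e)\<^sup>2 + (comb_norm A e')\<^sup>2)"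
  proof -
    have "(F\<^sup>2 + G\<^sup>2) * ((comb_norm A e)\<^sup>2 + (comb_norm A e')\<^sup>2) - (F * comb_norm A e + G * comb_norm A e')\<^sup>2 = (F * comb_norm A e' - G * comb_norm A e)\<^sup>2"
      by (simp add: power2_eq_square algebra_simps)
    then show ?thesis by (metis diff_ge_0_iff_ge zero_le_power2)
  qed
  also have "\<dots> = ((2 * F\<^sup>2 + 2 * G\<^sup>2) * (p * r)) * T" unfolding sum2 by (simp add: algebra_simps)
  finally have "T * T \<le> ((2 * F\<^sup>2 + 2 * G\<^sup>2) * (p * r)) * T" by (simp add: power2_eq_square)
  then have "T \<le> (2 * F\<^sup>2 + 2 * G\<^sup>2) * (p * r)"
  proof (cases "T = 0")
    case False
    then show ?thesis using \<open>T * T \<le> _\<close> T0 by (metis mult_le_cancel_right less_eq_real_def not_le)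
  qed (use pr in simp)
  then show ?thesis by (simp add: T_def X_def Y_def p_def r_def)
qed

text \<open>The suprema over the two combinations in \<open>parallelogram_functional\<close> are
  taken one after the other. For fixed d, varying c bounds the squared norm s^2 of the sum by M
  minus a quotient depending on d; rearranged, that quotient is at most M - s^2, and varying d
  bounds the norm of the difference.\<close>

lemma parallelogram_le:
  assumes f: "Hb_bound b f F" and g: "Hb_bound b g G"
  shows "(Hb_norm b (\<lambda>z. f z + g z))\<^sup>2 + (Hb_norm b (\<lambda>z. f z - g z))\<^sup>2 \<le> 2 * F\<^sup>2 + 2 * G\<^sup>2"
proof -
  define M where "M = 2 * F\<^sup>2 + 2 * G\<^sup>2"
  define s where "s = Hb_norm b (\<lambda>z. f z + g z)"
  have M0: "M \<ge> 0" by (simp add: M_def)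
  have s: "Hb_bound b (\<lambda>z. f z + g z) s" unfolding s_def using f g by (intro Hb_bound_Hb_norm in_Hb_add in_HbI)
  have key: "(norm (kernel_functional A c (\<lambda>z. f z + g z)))\<^sup>2 * dBR_form_on b B d
      + (norm (kernel_functional B d (\<lambda>z. f z - g z)))\<^sup>2 * dBR_form_on b A c \<le> M * (dBR_form_on b A c * dBR_form_on b B d)"
    if "finite A" "A \<subseteq> ball 0 1" "finite B" "B \<subseteq> ball 0 1" for A B c d
    using parallelogram_functional[OF f g, of "A \<union> B" "\<lambda>z. if z \<in> A then c z else 0" "\<lambda>z. if z \<in> B then d z else 0"] that
    by (simp add: kernel_functional_extend M_def)
  have small: "norm (kernel_functional A c h) \<le> sqrt K * comb_norm A c"
    if "(norm (kernel_functional A c h))\<^sup>2 \<le> K * dBR_form_on b A c" for A c h K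
    unfolding comb_norm_def real_sqrt_mult[symmetric] using that by (rule real_le_rsqrt)
  have cancel: "x \<le> y" if "x * r \<le> y * r" "r > 0" for x y r :: real using that by simp
  have sM: "s\<^sup>2 \<le> M - (norm (kernel_functional B d (\<lambda>z. f z - g z)))\<^sup>2 / dBR_form_on b B d"
    if B: "finite B" "B \<subseteq> ball 0 1" "dBR_form_on b B d > 0" for B d
  proof -
    define y r where "y = (norm (kernel_functional B d (\<lambda>z. f z - g z)))\<^sup>2" and "r = dBR_form_on b B d"
    have r: "r > 0" using B by (simp add: r_def)
    have "(norm (kernel_functional B d (\<lambda>z. f z + g z)))\<^sup>2 * r + y * r \<le> M * (r * r)"
      using key[OF B(1,2) B(1,2), of d d] by (simp only: y_def r_def)
    moreover have "(norm (kernel_functional B d (\<lambda>z. f z + g z)))\<^sup>2 * r \<ge> 0" using r by simp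
    ultimately have "y * r \<le> (M * r) * r" by (simp only: mult.assoc)
    then have "y \<le> M * r" by (rule cancel) (rule r)
    then have nn: "M - y / r \<ge> 0" using r by (simp add: field_simps)
    have "Hb_bound b (\<lambda>z. f z + g z) (sqrt (M - y / r))"
      unfolding Hb_bound_iff
    proof (intro conjI allI impI small)
      fix A c assume A: "finite A" "A \<subseteq> ball (0::complex) 1"
      show "(norm (kernel_functional A c (\<lambda>z. f z + g z)))\<^sup>2 \<le> (M - y / r) * dBR_form_on b A c"
      proof (rule cancel[OF _ r])
        have "(M - y / r) * dBR_form_on b A c * r = M * (dBR_form_on b A c * r) - y * dBR_form_on b A c"
          using r by (simp add: field_simps)
        moreover have "(norm (kernel_functional A c (\<lambda>z. f z + g z)))\<^sup>2 * r + y * dBR_form_on b A c \<le> M * (dBR_form_on b A c * r)"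
          using key[OF A B(1,2), of c d] by (simp only: y_def r_def)
        ultimately show "(norm (kernel_functional A c (\<lambda>z. f z + g z)))\<^sup>2 * r \<le> (M - y / r) * dBR_form_on b A c * r"
          by linarith
      qed
    qed (use nn in simp)
    then have "s \<le> sqrt (M - y / r)" unfolding s_def by (rule Hb_norm_le)
    then have "s\<^sup>2 \<le> (sqrt (M - y / r))\<^sup>2" using Hb_bound_nonneg[OF s] by (intro power_mono)
    then show ?thesis using nn by (simp add: y_def r_def)
  qed
  have diff_bound: "(norm (kernel_functional B d (\<lambda>z. f z - g z)))\<^sup>2 \<le> (M - s\<^sup>2) * dBR_form_on b B d"
    if B: "finite B" "B \<subseteq> ball 0 1" for B d
  proof (cases "dBR_form_on b B d > 0")
    case True
    then show ?thesis using sM[OF B True] by (simp add: field_simps)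
  next
    case False
    then have "dBR_form_on b B d = 0" using form_nonneg[OF B, of d] by simp
    then show ?thesis using Hb_boundD[OF Hb_bound_diff[OF f g] B, of d] by (simp add: comb_norm_def)
  qed
  \<comment> \<open>Obtained from c = d, so that no combination with positive form has to be
    exhibited.\<close>
  have "s\<^sup>2 \<le> M"
  proof -
    have "Hb_bound b (\<lambda>z. f z + g z) (sqrt M)"
      unfolding Hb_bound_iff
    proof (intro conjI allI impI small)
      fix A c assume A: "finite A" "A \<subseteq> ball (0::complex) 1"
      show "(norm (kernel_functional A c (\<lambda>z. f z + g z)))\<^sup>2 \<le> M * dBR_form_on b A c"
      proof (cases "dBR_form_on b A c > 0")
        case True
        show ?thesis
        proof (rule cancel[OF _ True])
          have "(norm (kernel_functional A c (\<lambda>z. f z - g z)))\<^sup>2 * dBR_form_on b A c \<ge> 0" using True by simp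
          then show "(norm (kernel_functional A c (\<lambda>z. f z + g z)))\<^sup>2 * dBR_form_on b A c \<le> M * dBR_form_on b A c * dBR_form_on b A c"
            using key[OF A A, of c c] by (simp add: mult.assoc)
        qed
      next
        case False
        then have "dBR_form_on b A c = 0" using form_nonneg[OF A, of c] by simp
        then show ?thesis using Hb_boundD[OF s A, of c] by (simp add: comb_norm_def)
      qed
    qed (use M0 in simp)
    then have "s \<le> sqrt M" unfolding s_def by (rule Hb_norm_le)
    then have "s\<^sup>2 \<le> (sqrt M)\<^sup>2" using Hb_bound_nonneg[OF s] by (intro power_mono)
    then show ?thesis using M0 by simp
  qed
  then have "Hb_bound b (\<lambda>z. f z - g z) (sqrt (M - s\<^sup>2))"
    unfolding Hb_bound_iff by (auto intro!: small diff_bound)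
  then have "Hb_norm b (\<lambda>z. f z - g z) \<le> sqrt (M - s\<^sup>2)" by (rule Hb_norm_le)
  then have "(Hb_norm b (\<lambda>z. f z - g z))\<^sup>2 \<le> (sqrt (M - s\<^sup>2))\<^sup>2"
    using Hb_norm_nonneg[OF in_Hb_diff[OF in_HbI[OF f] in_HbI[OF g]]] by (intro power_mono)
  then show ?thesis using \<open>s\<^sup>2 \<le> M\<close> by (simp add: M_def s_def)
qed

lemma Hb_norm_parallelogram:
  assumes f: "in_Hb b f" and g: "in_Hb b g"
  shows "(Hb_norm b (\<lambda>z. f z + g z))\<^sup>2 + (Hb_norm b (\<lambda>z. f z - g z))\<^sup>2 = 2 * (Hb_norm b f)\<^sup>2 + 2 * (Hb_norm b g)\<^sup>2"
proof (rule antisym)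
  show "(Hb_norm b (\<lambda>z. f z + g z))\<^sup>2 + (Hb_norm b (\<lambda>z. f z - g z))\<^sup>2 \<le> 2 * (Hb_norm b f)\<^sup>2 + 2 * (Hb_norm b g)\<^sup>2"
    by (intro parallelogram_le Hb_bound_Hb_norm assms)
  \<comment> \<open>The reverse inequality is the first one applied to f + g and f - g, whose sum
    and difference are 2 f and 2 g.\<close>
  have "(Hb_norm b (\<lambda>z. (f z + g z) + (f z - g z)))\<^sup>2 + (Hb_norm b (\<lambda>z. (f z + g z) - (f z - g z)))\<^sup>2
      \<le> 2 * (Hb_norm b (\<lambda>z. f z + g z))\<^sup>2 + 2 * (Hb_norm b (\<lambda>z. f z - g z))\<^sup>2"
    by (intro parallelogram_le Hb_bound_Hb_norm in_Hb_add in_Hb_diff assms)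
  moreover have "(\<lambda>z. (f z + g z) + (f z - g z)) = (\<lambda>z. 2 * f z)" "(\<lambda>z. (f z + g z) - (f z - g z)) = (\<lambda>z. 2 * g z)"
    by (auto simp: fun_eq_iff)
  ultimately show "2 * (Hb_norm b f)\<^sup>2 + 2 * (Hb_norm b g)\<^sup>2 \<le> (Hb_norm b (\<lambda>z. f z + g z))\<^sup>2 + (Hb_norm b (\<lambda>z. f z - g z))\<^sup>2"
    using Hb_norm_cmult[OF f, of 2] Hb_norm_cmult[OF g, of 2] by (simp add: power_mult_distrib)
qed

section \<open>Completeness and uniform boundedness in H(b)\<close>

text \<open>Holomorphy is recorded explicitly for the sake of Taylor coefficients. Values outside
  the disk stay free, so \<open>Hb_norm\<close> is only a seminorm on this set.\<close>

definition Hb_space :: "(complex \<Rightarrow> complex) set" where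
  "Hb_space = {f. in_Hb b f \<and> f holomorphic_on ball 0 1}"

lemma Hb_space_iff: "f \<in> Hb_space \<longleftrightarrow> in_Hb b f \<and> f holomorphic_on ball 0 1"
  by (simp add: Hb_space_def)

lemma Hb_space_add: "f \<in> Hb_space \<Longrightarrow> g \<in> Hb_space \<Longrightarrow> (\<lambda>z. f z + g z) \<in> Hb_space"
  and Hb_space_diff: "f \<in> Hb_space \<Longrightarrow> g \<in> Hb_space \<Longrightarrow> (\<lambda>z. f z - g z) \<in> Hb_space"
  and Hb_space_cmult: "f \<in> Hb_space \<Longrightarrow> (\<lambda>z. a * f z) \<in> Hb_space"
  and Hb_space_zero: "(\<lambda>z. 0) \<in> Hb_space"
  by (auto simp: Hb_space_def intro!: in_Hb_add in_Hb_diff in_Hb_cmult in_Hb_zero holomorphic_intros)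

text \<open>The bound 4^-k / 3 is the sum of 4^-j over j > k. \<open>Hb_bound_pointwise\<close>
  turns norm-Cauchy into locally uniformly Cauchy, which yields a holomorphic limit, and
  \<open>Hb_bound_limit\<close> carries the tail bound over to it.\<close>

lemma Hb_space_complete:
  assumes x: "\<And>k. x k \<in> Hb_space" and step: "\<And>k. Hb_norm b (\<lambda>z. x (Suc k) z - x k z) \<le> (1/4) ^ k"
  shows "\<exists>y\<in>Hb_space. \<forall>k. Hb_norm b (\<lambda>z. y z - x (Suc k) z) \<le> (1/4) ^ k / 3"
proof -
  have tail: "Hb_bound b (\<lambda>z. x (Suc k + i) z - x (Suc k) z) ((1/4) ^ k / 3)" for k i
  proof -
    have "Hb_bound b (\<lambda>z. x (Suc k + i) z - x (Suc k) z) (\<Sum>j<i. (1/4) ^ (Suc k + j))"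
    proof (induction i)
      case 0
      then show ?case using Hb_bound_zero by simp
    next
      case (Suc i)
      have "Hb_bound b (\<lambda>z. x (Suc (Suc k + i)) z - x (Suc k + i) z) ((1/4) ^ (Suc k + i))"
        by (rule Hb_bound_mono[OF Hb_bound_Hb_norm step]) (use x in \<open>auto simp: Hb_space_def intro!: in_Hb_diff\<close>)
      from Hb_bound_add[OF Suc this] show ?case by simp
    qed
    moreover have "(\<Sum>j<i. (1/4) ^ (Suc k + j)) \<le> (1/4 :: real) ^ k / 3"
    proof -
      have "(\<Sum>j<i. (1/4) ^ (Suc k + j)) = (1/4 :: real) ^ k / 3 * (1 - (1/4) ^ i)"
      proof (induction i)
        case (Suc i)
        have *: "a / 3 * (1 - c) + 1/4 * a * c = a / 3 * (1 - 1/4 * c)" for a c :: real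
          by (simp add: field_simps)
        have "(\<Sum>j<Suc i. (1/4) ^ (Suc k + j)) = (1/4) ^ k / 3 * (1 - (1/4) ^ i) + 1/4 * (1/4) ^ k * (1/4 :: real) ^ i"
          using Suc.IH by (simp add: power_add)
        also have "\<dots> = (1/4) ^ k / 3 * (1 - (1/4) ^ Suc i)" unfolding power_Suc by (rule *)
        finally show ?case .
      qed simp
      also have "\<dots> \<le> (1/4) ^ k / 3 * 1" by (intro mult_left_mono) auto
      finally show ?thesis by simp
    qed
    ultimately show ?thesis by (rule Hb_bound_mono)
  qed
  \<comment> \<open>Outside the disk the sequence may diverge and \<open>lim\<close> is then
    unspecified; membership in \<open>Hb_space\<close> does not see those values.\<close>
  define y where "y z = lim (\<lambda>n. x n z)" for z
  have unif: "uniform_limit (cball 0 \<rho>) x y sequentially" if "\<rho> < 1" for \<rho>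
  proof -
    have "uniformly_Cauchy_on (cball 0 \<rho>) x"
    proof (rule uniformly_Cauchy_onI')
      fix e :: real assume e: "e > 0"
      \<comment> \<open>Only rho < 1 is assumed; for rho < -1 the disk is empty and K is negative,
        hence the absolute values below.\<close>
      define K where "K = 1 / sqrt (1 - \<rho>\<^sup>2)"
      obtain k where "(1/4) ^ k < e / (\<bar>K\<bar> + 1)"
        using real_arch_pow_inv[of "e / (\<bar>K\<bar> + 1)" "1/4"] e by auto
      moreover have "\<bar>K\<bar> + 1 > 0" by simp
      ultimately have small: "(1/4) ^ k * (\<bar>K\<bar> + 1) < e" by (metis pos_less_divide_eq)
      have "(1/4) ^ k / 3 * \<bar>K\<bar> * 2 = 2/3 * ((1/4) ^ k * \<bar>K\<bar>)" by simp
      also have "\<dots> \<le> 1 * ((1/4) ^ k * (\<bar>K\<bar> + 1))" by (intro mult_mono) auto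
      also have "\<dots> = (1/4) ^ k * (\<bar>K\<bar> + 1)" by (rule mult_1)
      also note small
      finally have k: "(1/4) ^ k / 3 * \<bar>K\<bar> * 2 < e" .
      have close: "norm (x n z - x (Suc k) z) \<le> (1/4) ^ k / 3 * \<bar>K\<bar>" if "z \<in> cball 0 \<rho>" "n \<ge> Suc k" for n z
      proof -
        have "norm (x (Suc k + (n - Suc k)) z - x (Suc k) z) \<le> (1/4) ^ k / 3 / sqrt (1 - \<rho>\<^sup>2)"
          by (rule Hb_bound_pointwise[OF tail]) (use that \<open>\<rho> < 1\<close> in auto)
        also have "\<dots> = (1/4) ^ k / 3 * K" by (simp add: K_def)
        also have "\<dots> \<le> (1/4) ^ k / 3 * \<bar>K\<bar>" by (intro mult_left_mono) auto
        finally show ?thesis by (simp only: le_add_diff_inverse[OF that(2)])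
      qed
      show "\<exists>M. \<forall>z\<in>cball 0 \<rho>. \<forall>m\<ge>M. \<forall>n>m. dist (x m z) (x n z) < e"
      proof (intro exI ballI allI impI)
        fix z :: complex and m n assume z: "z \<in> cball 0 \<rho>" and "m \<ge> Suc k" "n > m"
        then have "dist (x m z) (x n z) \<le> norm (x m z - x (Suc k) z) + norm (x n z - x (Suc k) z)"
          using norm_triangle_ineq4[of "x m z - x (Suc k) z" "x n z - x (Suc k) z"] by (simp add: dist_norm)
        also have "\<dots> \<le> (1/4) ^ k / 3 * \<bar>K\<bar> + (1/4) ^ k / 3 * \<bar>K\<bar>"
          using \<open>m \<ge> Suc k\<close> \<open>n > m\<close> by (intro add_mono close[OF z]) auto
        also have "\<dots> < e" using k by (simp only: mult_2_right)
        finally show "dist (x m z) (x n z) < e" .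
      qed
    qed
    then have "uniformly_convergent_on (cball 0 \<rho>) x" by (rule Cauchy_uniformly_convergent)
    then show ?thesis unfolding uniformly_convergent_uniform_limit_iff y_def .
  qed
  have lim: "(\<lambda>n. x n z) \<longlonglongrightarrow> y z" if "z \<in> ball 0 1" for z
    using tendsto_uniform_limitI[OF unif[of "norm z"]] that by simp
  have holo: "y holomorphic_on ball 0 1"
  proof (rule holomorphic_uniform_sequence)
    fix w :: complex assume w: "w \<in> ball 0 1"
    define d where "d = (1 - norm w) / 2"
    have d: "d > 0" "norm w + d < 1" using w by (auto simp: d_def field_simps)
    have sub: "cball w d \<subseteq> cball 0 (norm w + d)"
      by (auto simp: dist_norm) (smt (verit) norm_triangle_ineq2 norm_minus_commute)
    show "\<exists>d>0. cball w d \<subseteq> ball 0 1 \<and> uniform_limit (cball w d) x y sequentially"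
    proof (intro exI conjI)
      show "cball w d \<subseteq> ball 0 1" using sub d by force
      show "uniform_limit (cball w d) x y sequentially" using unif[OF d(2)] sub by (rule uniform_limit_on_subset)
    qed (rule d)
  qed (use x in \<open>auto simp: Hb_space_def\<close>)
  have bound: "Hb_bound b (\<lambda>z. y z - x (Suc k) z) ((1/4) ^ k / 3)" for k
  proof (rule Hb_bound_limit)
    show "(\<lambda>n. x n z - x (Suc k) z) \<longlonglongrightarrow> y z - x (Suc k) z" if "z \<in> ball 0 1" for z
      by (intro tendsto_intros lim that)
    show "\<forall>\<^sub>F n in sequentially. Hb_bound b (\<lambda>z. x n z - x (Suc k) z) ((1/4) ^ k / 3)"
      using eventually_ge_at_top[of "Suc k"] by eventually_elim (metis tail le_add_diff_inverse)
  qed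
  have "in_Hb b (\<lambda>z. (y z - x (Suc 0) z) + x (Suc 0) z)"
    using in_HbI[OF bound] x by (intro in_Hb_add) (auto simp: Hb_space_def)
  then have "y \<in> Hb_space" using holo by (simp add: Hb_space_def)
  then show ?thesis using Hb_norm_le[OF bound] by blast
qed

text \<open>\<open>gliding_hump\<close> with pointwise addition of functions. It serves twice: for
  pairings with a weakly bounded sequence, and for rescaled Taylor coefficients.\<close>

lemma uniform_boundedness:
  fixes \<phi> :: "nat \<Rightarrow> (complex \<Rightarrow> complex) \<Rightarrow> complex"
  assumes add: "\<And>n f g. f \<in> Hb_space \<Longrightarrow> g \<in> Hb_space \<Longrightarrow> \<phi> n (\<lambda>z. f z + g z) = \<phi> n f + \<phi> n g"
    and "\<And>n. W n \<ge> 0" "\<And>n f. f \<in> Hb_space \<Longrightarrow> norm (\<phi> n f) \<le> W n * Hb_norm b f"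
    and "\<And>n r. r > 0 \<Longrightarrow> \<exists>\<xi>\<in>Hb_space. Hb_norm b \<xi> \<le> r \<and> W n * r / 2 \<le> norm (\<phi> n \<xi>)"
    and "\<And>f. f \<in> Hb_space \<Longrightarrow> \<exists>B. \<forall>n. norm (\<phi> n f) \<le> B"
  shows "\<exists>B. \<forall>n. W n \<le> B"
proof (rule gliding_hump[where X = Hb_space and N = "Hb_norm b" and \<phi> = \<phi>])
  show "0 \<in> Hb_space" using Hb_space_zero by (simp add: zero_fun_def)
  show "f + g \<in> Hb_space" if "f \<in> Hb_space" "g \<in> Hb_space" for f g
    using Hb_space_add[OF that] by (simp add: plus_fun_def)
  show "f - g \<in> Hb_space" if "f \<in> Hb_space" "g \<in> Hb_space" for f g
    using Hb_space_diff[OF that] by (simp add: fun_diff_def)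
  show "Hb_norm b (- f) = Hb_norm b f" if "f \<in> Hb_space" for f
    using Hb_norm_cmult[of f "-1"] that by (simp add: fun_Compl_def Hb_space_iff)
  show "\<exists>y\<in>Hb_space. \<forall>k. Hb_norm b (y - x (Suc k)) \<le> (1/4) ^ k / 3"
    if "\<And>k. x k \<in> Hb_space" "\<And>k. Hb_norm b (x (Suc k) - x k) \<le> (1/4) ^ k" for x
    using Hb_space_complete[of x] that by (simp add: fun_diff_def)
  show "\<phi> n (f + g) = \<phi> n f + \<phi> n g" if "f \<in> Hb_space" "g \<in> Hb_space" for n f g
    using add[OF that] by (simp add: plus_fun_def)
qed (use assms in auto)

text \<open>The functional g -> Re <f_n, g> has norm ||f_n||, so this is uniform boundedness. Real
  parts are embedded into the complex numbers to fit that lemma, which asks for additivity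
  only.\<close>

lemma weakly_bounded_imp_bounded:
  assumes f: "\<And>n. f n \<in> Hb_space"
    and weak: "\<And>g. g \<in> Hb_space \<Longrightarrow> \<exists>B. \<forall>n. \<bar>Re (Hb_inner b (f n) g)\<bar> \<le> B"
  shows "\<exists>B. \<forall>n::nat. Hb_norm b (f n) \<le> B"
proof (rule uniform_boundedness[where \<phi> = "\<lambda>n g. of_real (Re (Hb_inner b (f n) g))"])
  note in_Hb = f[unfolded Hb_space_iff, THEN conjunct1]
  let ?q = "\<lambda>h. (Hb_norm b h)\<^sup>2"
  show "of_real (Re (Hb_inner b (f n) (\<lambda>z. g z + h z))) = of_real (Re (Hb_inner b (f n) g)) + of_real (Re (Hb_inner b (f n) h))"
    if "g \<in> Hb_space" "h \<in> Hb_space" for n g h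
  proof -
    have "?q (f n + (g + h)) - ?q (f n - (g + h)) = (?q (f n + g) - ?q (f n - g)) + (?q (f n + h) - ?q (f n - h))"
    proof (rule polarization_additive[where X = Hb_space])
      show "?q (x + y) + ?q (x - y) = 2 * ?q x + 2 * ?q y" if "x \<in> Hb_space" "y \<in> Hb_space" for x y
        using Hb_norm_parallelogram[of x y] that by (simp add: plus_fun_def fun_diff_def Hb_space_iff)
    qed (use Hb_space_add Hb_space_diff f that in \<open>auto simp: plus_fun_def fun_diff_def\<close>)
    then show ?thesis
      unfolding Re_Hb_inner of_real_add[symmetric] of_real_eq_iff
      by (simp only: plus_fun_def fun_diff_def) (simp add: diff_divide_distrib add_divide_distrib)
  qed
  show "Hb_norm b (f n) \<ge> 0" for n using Hb_norm_nonneg in_Hb .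
  show "norm (of_real (Re (Hb_inner b (f n) g)) :: complex) \<le> Hb_norm b (f n) * Hb_norm b g" if "g \<in> Hb_space" for n g
  proof -
    define F G where "F = Hb_norm b (f n)" and "G = Hb_norm b g"
    define p m where "p = Hb_norm b (\<lambda>z. f n z + g z)" and "m = Hb_norm b (\<lambda>z. f n z - g z)"
    have g: "in_Hb b g" using that by (simp add: Hb_space_iff)
    have par: "p\<^sup>2 + m\<^sup>2 = 2 * F\<^sup>2 + 2 * G\<^sup>2"
      unfolding p_def m_def F_def G_def by (rule Hb_norm_parallelogram[OF in_Hb g])
    have "p \<le> F + G" unfolding p_def F_def G_def by (rule Hb_norm_triangle[OF in_Hb g])
    moreover have "m \<le> F + G"
      unfolding m_def F_def G_def by (intro Hb_norm_le Hb_bound_diff Hb_bound_Hb_norm in_Hb g)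
    moreover have "p \<ge> 0" "m \<ge> 0"
      unfolding p_def m_def by (intro Hb_norm_nonneg in_Hb_add in_Hb_diff in_Hb g)+
    ultimately have "p\<^sup>2 \<le> (F + G)\<^sup>2" "m\<^sup>2 \<le> (F + G)\<^sup>2" by (auto intro: power_mono)
    \<comment> \<open>Cauchy-Schwarz from the triangle inequality: p^2 - m^2 = 2 p^2 - (p^2 + m^2)
      is at most 2 (F + G)^2 - 2 F^2 - 2 G^2 = 4 F G, and likewise with p and m exchanged.\<close>
    then have "\<bar>p\<^sup>2 - m\<^sup>2\<bar> \<le> 4 * (F * G)" using par by (simp add: power2_sum abs_le_iff)
    then show ?thesis unfolding Re_Hb_inner norm_of_real by (simp add: p_def m_def F_def G_def)
  qed
  show "\<exists>\<xi>\<in>Hb_space. Hb_norm b \<xi> \<le> r \<and> Hb_norm b (f n) * r / 2 \<le> norm (of_real (Re (Hb_inner b (f n) \<xi>)) :: complex)"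
    if r: "r > 0" for n r
  proof (cases "Hb_norm b (f n) = 0")
    case True
    then show ?thesis using Hb_space_zero r Hb_norm_le[OF Hb_bound_zero] by (intro bexI[of _ "\<lambda>z. 0"]) auto
  next
    case False
    define F where "F = Hb_norm b (f n)"
    have F: "F > 0" using False Hb_norm_nonneg[OF in_Hb] unfolding F_def by (simp add: less_le)
    \<comment> \<open>The multiple c f_n has norm r and pairs with f_n to F r, the full norm of the
      functional times r.\<close>
    define c where "c = r / F"
    have c: "c > 0" using r F by (simp add: c_def)
    let ?\<xi> = "\<lambda>z. of_real c * f n z"
    have "Hb_norm b (\<lambda>z. f n z + ?\<xi> z) = (1 + c) * F"
    proof -
      have "(\<lambda>z. f n z + ?\<xi> z) = (\<lambda>z. of_real (1 + c) * f n z)" by (simp add: distrib_right)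
      then show ?thesis using c by (simp only: Hb_norm_cmult[OF in_Hb] norm_of_real F_def)
    qed
    moreover have "Hb_norm b (\<lambda>z. f n z - ?\<xi> z) = \<bar>1 - c\<bar> * F"
    proof -
      have "(\<lambda>z. f n z - ?\<xi> z) = (\<lambda>z. of_real (1 - c) * f n z)" by (simp add: left_diff_distrib)
      then show ?thesis by (simp only: Hb_norm_cmult[OF in_Hb] norm_of_real F_def)
    qed
    moreover have "((1 + c) * F)\<^sup>2 - (\<bar>1 - c\<bar> * F)\<^sup>2 = 4 * (c * F\<^sup>2)"
      unfolding power_mult_distrib power2_abs by (simp add: power2_sum power2_diff algebra_simps)
    ultimately have "Re (Hb_inner b (f n) ?\<xi>) = c * F\<^sup>2"
      unfolding Re_Hb_inner by (simp only:)
    also have "\<dots> = F * r" using F by (simp add: c_def power2_eq_square)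
    finally have "Hb_norm b (f n) * r / 2 \<le> norm (of_real (Re (Hb_inner b (f n) ?\<xi>)) :: complex)"
      using F r unfolding norm_of_real by (simp add: F_def)
    moreover have "Hb_norm b ?\<xi> \<le> r"
    proof -
      have "Hb_norm b ?\<xi> = \<bar>c\<bar> * F" by (simp only: Hb_norm_cmult[OF in_Hb] norm_of_real F_def)
      then show ?thesis using F r by (simp add: c_def)
    qed
    ultimately show ?thesis using Hb_space_cmult[OF f] by blast
  qed
  show "\<exists>B. \<forall>n. norm (of_real (Re (Hb_inner b (f n) g)) :: complex) \<le> B" if "g \<in> Hb_space" for g
    using weak[OF that] by simp
qed

section \<open>Norms of the Taylor coefficient functionals\<close>

lemma taylor_coeff_bounded: "\<exists>M\<ge>0. \<forall>f\<in>Hb_space. norm (taylor_coeff f n) \<le> M * Hb_norm b f"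
proof (intro exI conjI ballI)
  fix f assume f: "f \<in> Hb_space"
  have "norm (taylor_coeff f n) \<le> Hb_norm b f / sqrt (1 - (1/2)\<^sup>2) * 2 ^ n"
    by (rule taylor_coeff_bound) (use f in \<open>auto simp: Hb_space_iff intro!: Hb_bound_pointwise[OF Hb_bound_Hb_norm]\<close>)
  then show "norm (taylor_coeff f n) \<le> (2 ^ n / sqrt (1 - (1/2)\<^sup>2)) * Hb_norm b f" by (simp add: mult.commute)
qed (simp add: power2_eq_square)

definition coeff_norm :: "nat \<Rightarrow> real" where
  "coeff_norm n = (SUP f\<in>{f\<in>Hb_space. Hb_norm b f \<le> 1}. norm (taylor_coeff f n))"

lemma coeff_norm_upper: "f \<in> Hb_space \<Longrightarrow> Hb_norm b f \<le> 1 \<Longrightarrow> norm (taylor_coeff f n) \<le> coeff_norm n"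
  unfolding coeff_norm_def
proof (rule cSUP_upper)
  obtain M where M: "M \<ge> 0" "\<forall>f\<in>Hb_space. norm (taylor_coeff f n) \<le> M * Hb_norm b f" using taylor_coeff_bounded by blast
  show "bdd_above ((\<lambda>f. norm (taylor_coeff f n)) ` {f\<in>Hb_space. Hb_norm b f \<le> 1})"
  proof (rule bdd_aboveI[of _ M])
    fix x assume "x \<in> (\<lambda>f. norm (taylor_coeff f n)) ` {f\<in>Hb_space. Hb_norm b f \<le> 1}"
    then obtain f where f: "f \<in> Hb_space" "Hb_norm b f \<le> 1" "x = norm (taylor_coeff f n)" by blast
    then have "x \<le> M * Hb_norm b f" using M by blast
    also have "\<dots> \<le> M" using mult_left_le[OF f(2) M(1)] .
    finally show "x \<le> M" .
  qed
qed auto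

lemma coeff_norm_nonneg: "coeff_norm n \<ge> 0"
  using order_trans[OF norm_ge_zero coeff_norm_upper[OF Hb_space_zero]] Hb_norm_le[OF Hb_bound_zero] by simp

lemma taylor_coeff_le_coeff_norm:
  assumes f: "f \<in> Hb_space"
  shows "norm (taylor_coeff f n) \<le> coeff_norm n * Hb_norm b f"
proof (cases "Hb_norm b f = 0")
  case True
  \<comment> \<open>Rescaling to norm 1 is impossible here; the crude bound M times 0 makes the
    coefficient vanish.\<close>
  then show ?thesis using taylor_coeff_bounded f by fastforce
next
  case False
  have in_Hb: "in_Hb b f" and h: "f holomorphic_on ball 0 1" using f by (auto simp: Hb_space_iff)
  have pos: "Hb_norm b f > 0" using False Hb_norm_nonneg[OF in_Hb] by simp
  let ?c = "complex_of_real (1 / Hb_norm b f)"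
  have "norm (taylor_coeff (\<lambda>z. ?c * f z) n) \<le> coeff_norm n"
    by (rule coeff_norm_upper[OF Hb_space_cmult[OF f]]) (use Hb_norm_cmult[OF in_Hb, of ?c] pos in \<open>simp add: norm_divide\<close>)
  then show ?thesis using pos unfolding taylor_coeff_cmult[OF h] norm_mult norm_of_real by (simp add: field_simps)
qed

lemma coeff_norm_attained:
  assumes "r > 0"
  shows "\<exists>\<xi>\<in>Hb_space. Hb_norm b \<xi> \<le> r \<and> coeff_norm n * r / 2 \<le> norm (taylor_coeff \<xi> n)"
proof (cases "coeff_norm n = 0")
  case True
  then show ?thesis using Hb_space_zero assms Hb_norm_le[OF Hb_bound_zero] by (intro bexI[of _ "\<lambda>z. 0"]) auto
next
  case False
  then have "coeff_norm n / 2 < coeff_norm n" using coeff_norm_nonneg[of n] by simp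
  then have "\<exists>y\<in>(\<lambda>f. norm (taylor_coeff f n)) ` {f\<in>Hb_space. Hb_norm b f \<le> 1}. coeff_norm n / 2 < y"
    unfolding coeff_norm_def using Hb_space_zero Hb_norm_le[OF Hb_bound_zero] by (intro less_cSupD) (auto intro: exI[of _ "\<lambda>z. 0"])
  then obtain f where f: "f \<in> Hb_space" "Hb_norm b f \<le> 1" "coeff_norm n / 2 < norm (taylor_coeff f n)" by blast
  have "Hb_norm b (\<lambda>z. of_real r * f z) \<le> r"
    using Hb_norm_cmult[of f "of_real r"] f assms by (simp add: Hb_space_iff mult_left_le)
  moreover have "norm (taylor_coeff (\<lambda>z. of_real r * f z) n) \<ge> coeff_norm n * r / 2"
    using f assms by (simp add: Hb_space_iff taylor_coeff_cmult norm_mult)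
  ultimately show ?thesis using Hb_space_cmult[OF f(1)] by blast
qed

section \<open>Polynomials in H(b)\<close>

lemma Hb_bound_conj_toeplitz_monomial: "Hb_bound b (conj_toeplitz_monomial u k) 1"
  using form_ge_square by (simp add: Hb_bound_iff_square)

lemma nonzero_polynomials_in_unit_ball:
  obtains a :: "nat \<Rightarrow> nat \<Rightarrow> complex" and \<delta>
  where "\<And>n. Hb_bound b (\<lambda>z. \<Sum>i\<le>n. a n i * z ^ i) 1" "\<And>n. norm (a n n) = \<delta>" "\<delta> > 0"
proof -
  have "\<exists>m. taylor_coeff u m \<noteq> 0"
  proof (rule ccontr)
    assume "\<nexists>m. taylor_coeff u m \<noteq> 0"
    then have "(deriv ^^ m) u 0 = 0" for m by (simp add: taylor_coeff_def)
    then have "u z = 0" if "z \<in> ball 0 1" for z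
      using holomorphic_fun_eq_0_on_ball[OF u_holo that] by blast
    then show False using u_nonzero by blast
  qed
  define p where "p = (LEAST m. taylor_coeff u m \<noteq> 0)"
  have p: "taylor_coeff u p \<noteq> 0" "\<And>m. m < p \<Longrightarrow> taylor_coeff u m = 0"
    using LeastI_ex[OF \<open>\<exists>m. _ m\<close>] not_less_Least unfolding p_def by blast+
  show thesis
  proof
    show "norm (cnj (taylor_coeff u (n + p - n))) = norm (taylor_coeff u p)" for n by simp
    show "norm (taylor_coeff u p) > 0" using p by simp
    show "Hb_bound b (\<lambda>z. \<Sum>i\<le>n. cnj (taylor_coeff u (n + p - i)) * z ^ i) 1" for n
    proof -
      have "conj_toeplitz_monomial u (n + p) z = (\<Sum>i\<le>n. cnj (taylor_coeff u (n + p - i)) * z ^ i)" for z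
      proof -
        have "conj_toeplitz_monomial u (n + p) z = (\<Sum>i\<le>n + p. cnj (taylor_coeff u (n + p - i)) * z ^ i)"
          unfolding conj_toeplitz_monomial_def
          by (rule sum.reindex_bij_witness[of _ "\<lambda>i. n + p - i" "\<lambda>i. n + p - i"]) auto
        \<comment> \<open>For i > n the index n + p - i lies below p, where the coefficients of u
          vanish.\<close>
        also have "\<dots> = (\<Sum>i\<le>n. cnj (taylor_coeff u (n + p - i)) * z ^ i)"
          by (rule sum.mono_neutral_right) (auto intro!: p(2))
        finally show ?thesis .
      qed
      then have "conj_toeplitz_monomial u (n + p) = (\<lambda>z. \<Sum>i\<le>n. cnj (taylor_coeff u (n + p - i)) * z ^ i)" by (rule ext)
      then show ?thesis using Hb_bound_conj_toeplitz_monomial[of "n + p"] by (simp only:)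
    qed
  qed
qed

text \<open>Strong induction: the lower monomials are subtracted from a polynomial of degree n in
  H(b) with nonzero leading coefficient.\<close>

lemma in_Hb_monomial: "in_Hb b (\<lambda>z. z ^ n)"
proof (induction n rule: less_induct)
  case (less n)
  obtain a \<delta> where a: "\<And>n. Hb_bound b (\<lambda>z. \<Sum>i\<le>n. a n i * z ^ i) 1" "\<And>n. norm (a n n) = \<delta>" "\<delta> > 0"
    using nonzero_polynomials_in_unit_ball by blast
  have "in_Hb b (\<lambda>z. inverse (a n n) * ((\<Sum>i\<le>n. a n i * z ^ i) - (\<Sum>i<n. a n i * z ^ i)))"
    by (intro in_Hb_cmult in_Hb_diff in_HbI[OF a(1)] Hb_norm_sum(1) less) auto
  moreover have "inverse (a n n) * ((\<Sum>i\<le>n. a n i * z ^ i) - (\<Sum>i<n. a n i * z ^ i)) = z ^ n" for z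
  proof -
    have "a n n \<noteq> 0" using a(2)[of n] a(3) by auto
    then show ?thesis by (simp add: lessThan_Suc_atMost[symmetric])
  qed
  ultimately show ?case by simp
qed

lemma sigma_mean_in_Hb_space: "sigma_mean \<alpha> n h \<in> Hb_space"
  unfolding sigma_mean_def Hb_space_iff
  by (intro conjI Hb_norm_sum(1) in_Hb_cmult in_Hb_monomial holomorphic_intros) auto

lemma coeff_norm_bounded_below: "\<exists>\<delta>>0. \<forall>n. coeff_norm n \<ge> \<delta>"
proof -
  obtain a \<delta> where a: "\<And>n. Hb_bound b (\<lambda>z. \<Sum>i\<le>n. a n i * z ^ i) 1" "\<And>n. norm (a n n) = \<delta>" "\<delta> > 0"
    using nonzero_polynomials_in_unit_ball by blast
  have "coeff_norm n \<ge> \<delta>" for n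
  proof -
    have "(\<lambda>z. \<Sum>i\<le>n. a n i * z ^ i) \<in> Hb_space"
      using in_HbI[OF a(1)] by (auto simp: Hb_space_iff intro!: holomorphic_intros)
    from coeff_norm_upper[OF this Hb_norm_le[OF a(1)], of n] show ?thesis
      by (simp add: taylor_coeff_polynomial a(2))
  qed
  then show ?thesis using a(3) by blast
qed

section \<open>From bounded means to the growth of monomial norms\<close>

text \<open>The two kinds of convergence enter the proof only here, and only as boundedness of the
  means for each h.\<close>

lemma sigma_mean_bounded:
  assumes h: "h \<in> Hb_space"
    and "(\<forall>h. in_Hb b h \<longrightarrow> (\<forall>g. in_Hb b g \<longrightarrow>
            (\<lambda>n. Hb_inner b (sigma_mean \<alpha> n h) g) \<longlonglongrightarrow> Hb_inner b h g))
       \<or> (\<forall>h. in_Hb b h \<longrightarrow>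
            (\<lambda>n. Hb_norm b (\<lambda>z. sigma_mean \<alpha> n h z - h z)) \<longlonglongrightarrow> 0)"
  shows "\<exists>B. \<forall>n. Hb_norm b (sigma_mean \<alpha> n h) \<le> B"
proof -
  have in_h: "in_Hb b h" using h by (simp add: Hb_space_iff)
  show ?thesis
    using assms(2)
  proof
    assume weak: "\<forall>h. in_Hb b h \<longrightarrow> (\<forall>g. in_Hb b g \<longrightarrow>
            (\<lambda>n. Hb_inner b (sigma_mean \<alpha> n h) g) \<longlonglongrightarrow> Hb_inner b h g)"
    show ?thesis
    proof (rule weakly_bounded_imp_bounded[OF sigma_mean_in_Hb_space])
      fix g assume "g \<in> Hb_space"
      then have "(\<lambda>n. Re (Hb_inner b (sigma_mean \<alpha> n h) g)) \<longlonglongrightarrow> Re (Hb_inner b h g)"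
        using weak in_h by (intro tendsto_Re) (simp add: Hb_space_iff)
      from convergent_imp_Bseq[OF convergentI[OF this]]
      show "\<exists>B. \<forall>n. \<bar>Re (Hb_inner b (sigma_mean \<alpha> n h) g)\<bar> \<le> B"
        by (metis BseqE real_norm_def)
    qed
  next
    assume strong: "\<forall>h. in_Hb b h \<longrightarrow> (\<lambda>n. Hb_norm b (\<lambda>z. sigma_mean \<alpha> n h z - h z)) \<longlonglongrightarrow> 0"
    then have "Bseq (\<lambda>n. Hb_norm b (\<lambda>z. sigma_mean \<alpha> n h z - h z))"
      using in_h by (blast intro: convergent_imp_Bseq convergentI)
    then obtain K where K: "\<And>n. norm (Hb_norm b (\<lambda>z. sigma_mean \<alpha> n h z - h z)) \<le> K" by (meson BseqE)
    have "Hb_norm b (sigma_mean \<alpha> n h) \<le> K + Hb_norm b h" for n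
      using Hb_norm_triangle[OF in_Hb_diff in_h, of "sigma_mean \<alpha> n h" h] sigma_mean_in_Hb_space[of \<alpha> n h] in_h
        K[of n] by (simp add: Hb_space_iff)
    then show ?thesis by blast
  qed
qed

lemma coeff_monomial_bound:
  assumes \<alpha>: "\<alpha> \<ge> 0" and h: "h \<in> Hb_space" and B: "\<And>n. Hb_norm b (sigma_mean \<alpha> n h) \<le> B"
  shows "norm (taylor_coeff h n) * Hb_norm b (\<lambda>z. z ^ n) \<le> ((real n + \<alpha>) gchoose n) * ((\<Sum>m. \<bar>(\<alpha> + 1) gchoose m\<bar>) * B)"
proof -
  define D where "D m = (-1) ^ m * ((\<alpha> + 1) gchoose m)" for m
  define A where "A m = (real m + \<alpha>) gchoose m" for m
  have A: "A k > 0" "k \<le> n \<Longrightarrow> A k \<le> A n" for k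
    unfolding A_def using gbinomial_add_of_nat_pos[OF \<alpha>] gbinomial_add_of_nat_mono[OF \<alpha>] by auto
  have sig: "in_Hb b (sigma_mean \<alpha> k h)" for k using sigma_mean_in_Hb_space by (simp add: Hb_space_iff)
  have B0: "B \<ge> 0" using Hb_norm_nonneg[OF sig] B order_trans by blast
  have absD: "\<bar>D m\<bar> = \<bar>(\<alpha> + 1) gchoose m\<bar>" for m by (simp add: D_def abs_mult power_abs)
  have "norm (taylor_coeff h n) * Hb_norm b (\<lambda>z. z ^ n) = Hb_norm b (\<lambda>z. taylor_coeff h n * z ^ n)"
    by (rule Hb_norm_cmult[OF in_Hb_monomial, symmetric])
  also have "\<dots> = Hb_norm b (\<lambda>z. \<Sum>k\<le>n. of_real (D (n - k) * A k) * sigma_mean \<alpha> k h z)"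
    unfolding D_def A_def sigma_mean_inversion[OF \<alpha>] ..
  also have "\<dots> \<le> (\<Sum>k\<le>n. Hb_norm b (\<lambda>z. of_real (D (n - k) * A k) * sigma_mean \<alpha> k h z))"
    by (intro Hb_norm_sum in_Hb_cmult sig) auto
  also have "\<dots> = (\<Sum>k\<le>n. \<bar>D (n - k)\<bar> * A k * Hb_norm b (sigma_mean \<alpha> k h))"
    by (intro sum.cong refl) (simp only: Hb_norm_cmult[OF sig] norm_of_real abs_mult abs_of_pos[OF A(1)])
  \<comment> \<open>Monotonicity of \<open>A\<close> pulls out \<open>A n\<close>; the remaining sum
    of |D| is bounded independently of n.\<close>
  also have "\<dots> \<le> (\<Sum>k\<le>n. \<bar>D (n - k)\<bar> * A n * B)"
    using A B Hb_norm_nonneg[OF sig] by (intro sum_mono mult_mono mult_left_mono) (auto intro!: mult_nonneg_nonneg less_imp_le[OF A(1)])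
  also have "\<dots> = A n * ((\<Sum>k\<le>n. \<bar>D (n - k)\<bar>) * B)"
    by (simp add: sum_distrib_left sum_distrib_right mult_ac)
  also have "(\<Sum>k\<le>n. \<bar>D (n - k)\<bar>) = (\<Sum>m\<le>n. \<bar>(\<alpha> + 1) gchoose m\<bar>)"
    unfolding absD by (rule sum.reindex_bij_witness[of _ "\<lambda>i. n - i" "\<lambda>i. n - i"]) auto
  also have "A n * (\<dots> * B) \<le> A n * ((\<Sum>m. \<bar>(\<alpha> + 1) gchoose m\<bar>) * B)"
    using A(1)[of n] B0 summable_abs_gbinomial[OF \<alpha>]
    by (intro mult_left_mono mult_right_mono sum_le_suminf) auto
  finally show ?thesis by (simp add: A_def)
qed

lemma Hb_norm_monomial_bigo:
  assumes \<alpha>: "\<alpha> \<ge> 0" and bounded: "\<And>h. h \<in> Hb_space \<Longrightarrow> \<exists>B. \<forall>n. Hb_norm b (sigma_mean \<alpha> n h) \<le> B"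
  shows "(\<lambda>j. Hb_norm b (\<lambda>z. z ^ j)) \<in> O(\<lambda>j. real j powr \<alpha>)"
proof -
  define A where "A n = (real n + \<alpha>) gchoose n" for n
  have A: "A n > 0" for n unfolding A_def using gbinomial_add_of_nat_pos[OF \<alpha>] by auto
  \<comment> \<open>Scaling the n-th coefficient functional by this factor makes
    \<open>coeff_monomial_bound\<close> a bound independent of n for each h; the scaled functional
    has norm \<open>coeff_norm n * \<kappa> n\<close>.\<close>
  define \<kappa> where "\<kappa> n = Hb_norm b (\<lambda>z. z ^ n) / A n" for n
  have \<kappa>: "\<kappa> n \<ge> 0" for n
    unfolding \<kappa>_def using Hb_norm_nonneg[OF in_Hb_monomial] A less_imp_le by (intro divide_nonneg_nonneg) auto
  have "\<exists>B. \<forall>n. coeff_norm n * \<kappa> n \<le> B"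
  proof (rule uniform_boundedness[where \<phi> = "\<lambda>n f. taylor_coeff f n * of_real (\<kappa> n)"])
    show "taylor_coeff (\<lambda>z. f z + g z) n * of_real (\<kappa> n) = taylor_coeff f n * of_real (\<kappa> n) + taylor_coeff g n * of_real (\<kappa> n)"
      if "f \<in> Hb_space" "g \<in> Hb_space" for n f g
      using that by (simp add: Hb_space_iff taylor_coeff_add distrib_right)
    show "coeff_norm n * \<kappa> n \<ge> 0" for n using coeff_norm_nonneg \<kappa> by simp
    show "norm (taylor_coeff f n * of_real (\<kappa> n)) \<le> coeff_norm n * \<kappa> n * Hb_norm b f" if "f \<in> Hb_space" for n f
      using mult_right_mono[OF taylor_coeff_le_coeff_norm[OF that, of n] \<kappa>[of n]] \<kappa>[of n]
      by (simp add: norm_mult mult_ac)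
    show "\<exists>\<xi>\<in>Hb_space. Hb_norm b \<xi> \<le> r \<and> coeff_norm n * \<kappa> n * r / 2 \<le> norm (taylor_coeff \<xi> n * of_real (\<kappa> n))"
      if r: "r > 0" for n r
    proof -
      obtain \<xi> where \<xi>: "\<xi> \<in> Hb_space" "Hb_norm b \<xi> \<le> r" "coeff_norm n * r / 2 \<le> norm (taylor_coeff \<xi> n)"
        using coeff_norm_attained[OF r] by blast
      then show ?thesis using mult_right_mono[OF \<xi>(3) \<kappa>[of n]] \<kappa>[of n]
        by (intro bexI[of _ \<xi>]) (simp_all add: norm_mult mult_ac)
    qed
    show "\<exists>B. \<forall>n. norm (taylor_coeff h n * of_real (\<kappa> n)) \<le> B" if h: "h \<in> Hb_space" for h
    proof -
      obtain B where B: "\<And>n. Hb_norm b (sigma_mean \<alpha> n h) \<le> B" using bounded[OF h] by blast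
      have "norm (taylor_coeff h n * of_real (\<kappa> n)) \<le> (\<Sum>m. \<bar>(\<alpha> + 1) gchoose m\<bar>) * B" for n
      proof -
        have "norm (taylor_coeff h n * of_real (\<kappa> n)) = norm (taylor_coeff h n) * \<kappa> n"
          using \<kappa>[of n] by (simp add: norm_mult)
        then show ?thesis using coeff_monomial_bound[OF \<alpha> h B, of n] A[of n]
          by (simp add: \<kappa>_def A_def[symmetric] pos_divide_le_eq mult.commute)
      qed
      then show ?thesis by blast
    qed
  qed
  then obtain B where B: "\<And>n. coeff_norm n * \<kappa> n \<le> B" by blast
  obtain \<delta> where \<delta>: "\<delta> > 0" "\<And>n. coeff_norm n \<ge> \<delta>" using coeff_norm_bounded_below by blast
  have "norm (Hb_norm b (\<lambda>z. z ^ n)) \<le> B / \<delta> * norm (A n)" for n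
  proof -
    have "\<delta> * \<kappa> n \<le> B" using mult_right_mono[OF \<delta>(2) \<kappa>] B order_trans by blast
    then have "\<kappa> n \<le> B / \<delta>" using \<delta>(1) by (simp add: pos_le_divide_eq mult.commute)
    then show ?thesis using A[of n] Hb_norm_nonneg[OF in_Hb_monomial, of n] by (simp add: \<kappa>_def pos_divide_le_eq)
  qed
  then have "(\<lambda>j. Hb_norm b (\<lambda>z. z ^ j)) \<in> O(A)" by (intro bigoI[of _ "B / \<delta>"] always_eventually allI)
  moreover have "A \<in> O(\<lambda>j. real j powr \<alpha>)" unfolding A_def by (rule gbinomial_add_of_nat_bigo)
  ultimately show ?thesis by (rule landau_o.big_trans)
qed

end

section \<open>Non-extreme symbols and the conclusion\<close>

lemma nonextreme_imp_dBR_symbol: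
  assumes "nonextreme b"
  shows "\<exists>u. dBR_symbol b u"
proof -
  obtain f g where f: "Hinf_ball f" and g: "Hinf_ball g" and ne: "\<exists>z\<in>ball 0 1. f z \<noteq> g z"
    and mid: "\<And>z. z \<in> ball 0 1 \<Longrightarrow> b z = (f z + g z) / 2" and b: "Hinf_ball b"
    using assms unfolding nonextreme_def by blast
  have "dBR_symbol b (\<lambda>z. (f z - g z) / 2)"
  proof
    show "b holomorphic_on ball 0 1" "(\<lambda>z. (f z - g z) / 2) holomorphic_on ball 0 1"
      using b f g by (auto simp: Hinf_ball_def intro!: holomorphic_intros)
    show "\<exists>z\<in>ball 0 1. (f z - g z) / 2 \<noteq> 0" using ne by auto
    show "(norm (b z))\<^sup>2 + (norm ((f z - g z) / 2))\<^sup>2 \<le> 1" if z: "z \<in> ball 0 1" for z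
    proof -
      have "(norm (f z))\<^sup>2 \<le> 1" "(norm (g z))\<^sup>2 \<le> 1"
        using f g z by (auto simp: Hinf_ball_def abs_square_le_1)
      \<comment> \<open>The parallelogram identity in the complex plane.\<close>
      moreover have "(norm (b z))\<^sup>2 + (norm ((f z - g z) / 2))\<^sup>2 = ((norm (f z))\<^sup>2 + (norm (g z))\<^sup>2) / 2"
        unfolding mid[OF z] norm_divide power_divide cmod_power2 plus_complex.sel minus_complex.sel power2_sum power2_diff
        by (simp add: add_divide_distrib diff_divide_distrib)
      ultimately show ?thesis by simp
    qed
  qed
  then show ?thesis by blast
qed

theorem theorem6p10:
  fixes b :: "complex \<Rightarrow> complex" and \<alpha> :: real
  assumes "nonextreme b"
    and "\<alpha> \<ge> 0"
    and "(\<forall>h. in_Hb b h \<longrightarrow> (\<forall>g. in_Hb b g \<longrightarrow>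
            (\<lambda>n. Hb_inner b (sigma_mean \<alpha> n h) g) \<longlonglongrightarrow> Hb_inner b h g))
       \<or> (\<forall>h. in_Hb b h \<longrightarrow>
            (\<lambda>n. Hb_norm b (\<lambda>z. sigma_mean \<alpha> n h z - h z)) \<longlonglongrightarrow> 0)"
  shows "(\<lambda>j::nat. Hb_norm b (\<lambda>z. z ^ j)) \<in> O(\<lambda>j. real j powr \<alpha>)"
proof -
  obtain u where "dBR_symbol b u" using nonextreme_imp_dBR_symbol[OF assms(1)] by blast
  then interpret dBR_symbol b u .
  show ?thesis
    using Hb_norm_monomial_bigo[OF assms(2)] sigma_mean_bounded[OF _ assms(3)] by blast
qed

end
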